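(* Let $A$, $B'$, $C$ be matrices in $\mathbb{C}^{d\times d}$, with $C+kI$ invertible for all integers $k\ge0$. Then the matrix function $\mathcal{H}_4(A,B';C;x,y)$ satisfies the following differential formulae, where $r$ is a positive integer: (1) $\dfrac{\partial^r}{\partial x^r}\mathcal{H}_4(A,B';C;x,y)=(A)_r\,\mathcal{H}_4(A+rI,B';C+rI;x,y)\,(C)_r^{-1}$; (2) if $B'C=CB'$, $\dfrac{\partial^r}{\partial y^r}\mathcal{H}_4(A,B';C;x,y)=(-1)^r(I-A)_r^{-1}\,\mathcal{H}_4(A-rI,B'+rI;C;x,y)\,(B')_r$; (3) $\Big(x^2\dfrac{\partial}{\partial x}\Big)^r\big[x^{A+(r-1)I}\mathcal{H}_4(A,B';C;x,\tfrac{y}{x})\big]=x^{A+rI}(A)_r\,\mathcal{H}_4(A+rI,B';C;x,\tfrac{y}{x})$; (4) if $B'C=CB'$, $\Big(y^2\dfrac{\partial}{\partial y}\Big)^r\big[\mathcal{H}_4(A,B';C;x,y)\,y^{B'+(r-1)I}\big]=\mathcal{H}_4(A,B'+rI;C;x,y)\,y^{B'+rI}(B')_r$; (5) $\dfrac{\partial^r}{\partial x^r}\big[\mathcal{H}_4(A,B';C;x,y)\,x^{C-I}\big]=(-1)^r\,\mathcal{H}_4(A,B';C-rI;x,y)\,x^{C-(r+1)I}(I-C)_r$.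
   Context: $\mathcal{H}_4(A,B';C;x,y)=\sum_{m,n\ge0}(A)_{m-n}(B')_n(C)_m^{-1}\frac{x^m y^n}{m!\,n!}$. Matrix Pochhammer symbol: for $M\in\mathbb{C}^{d\times d}$, $(M)_0=I$, $(M)_n=M(M+I)\cdots(M+(n-1)I)$ for $n\ge1$, and $(M)_{-n}=(-1)^n(I-M)_n^{-1}$; $(M)_n^{-1}$ is the inverse matrix of $(M)_n$. Matrix powers: $x^M=\exp(M\log x)$.
   Formalization: In (3) and (4) the inner powers are x^A and y^{B'} instead of x^{A+(r-1)I} and y^{B'+(r-1)I}, since the printed formulae fail for r ≥ 2; invertibility needed to define each H_4 is assumed, and powers use the principal log off the cut. *)

theory Defs
  imports "HOL-Analysis.Analysis"
begin

text \<open>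
  Matrices are of type \<^typ>\<open>complex^'d^'d\<close>, with \<open>**\<close> as product and \<open>mat c\<close> as \<open>c I\<close>
  (the class operation \<open>*\<close> on this type is entrywise, so the library's \<^const>\<open>exp\<close> and the
  power operation do not apply to it).
\<close>

definition cscale :: "complex \<Rightarrow> complex^'d^'d \<Rightarrow> complex^'d^'d" (infixr "*\<^sub>M" 75) where
  "c *\<^sub>M M = map_matrix (\<lambda>z. c * z) M"

primrec matrix_power :: "complex^'d^'d \<Rightarrow> nat \<Rightarrow> complex^'d^'d" where
  "matrix_power M 0 = mat 1"
| "matrix_power M (Suc n) = matrix_power M n ** M"

definition matrix_exp :: "complex^'d^'d \<Rightarrow> complex^'d^'d" where
  "matrix_exp M = (\<Sum>n. (1 / fact n) *\<^sub>M matrix_power M n)"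

text \<open>\<open>x\<^sup>M\<close> with the principal logarithm; only meant for \<open>x \<noteq> 0\<close>.\<close>

definition cpow_matrix :: "complex \<Rightarrow> complex^'d^'d \<Rightarrow> complex^'d^'d" where
  "cpow_matrix x M = matrix_exp (Ln x *\<^sub>M M)"

primrec mpoch :: "complex^'d^'d \<Rightarrow> nat \<Rightarrow> complex^'d^'d" where
  "mpoch M 0 = mat 1"
| "mpoch M (Suc n) = mpoch M n ** (M + mat (of_nat n))"

text \<open>
  The Pochhammer symbol with integer index. For index \<open>-n < 0\<close> it is meaningful only if
  \<open>M - kI\<close> is invertible for \<open>1 \<le> k \<le> n\<close>.
\<close>

definition mpoch_int :: "complex^'d^'d \<Rightarrow> int \<Rightarrow> complex^'d^'d" where
  "mpoch_int M k =
     (if k \<ge> 0 then mpoch M (nat k)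
      else (-1) ^ nat (-k) *\<^sub>M matrix_inv (mpoch (mat 1 - M) (nat (-k))))"

text \<open>
  The double series is an unordered sum over all pairs of naturals. Its terms are meaningful only
  if \<open>A - kI\<close> (\<open>k \<ge> 1\<close>) and \<open>C + kI\<close> (\<open>k \<ge> 0\<close>) are invertible; it then
  converges absolutely for all complex \<open>x\<close> and \<open>y\<close>.
\<close>

definition horn_H4 ::
  "complex^'d^'d \<Rightarrow> complex^'d^'d \<Rightarrow> complex^'d^'d \<Rightarrow> complex \<Rightarrow> complex \<Rightarrow> complex^'d^'d" where
  "horn_H4 A B C x y =
     (\<Sum>\<^sub>\<infinity>(m, n)\<in>UNIV. (x ^ m * y ^ n / (fact m * fact n)) *\<^sub>M
        (mpoch_int A (int m - int n) ** mpoch B n ** matrix_inv (mpoch C m)))"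

definition mderiv :: "(complex \<Rightarrow> complex^'d^'d) \<Rightarrow> complex \<Rightarrow> complex^'d^'d" where
  "mderiv f x = (\<chi> i j. deriv (\<lambda>t. f t $ i $ j) x)"

text \<open>
  The operator \<open>x\<^sup>2 d/dx\<close>; its powers are iterates. It sends the power of \<open>x\<close> with exponent \<open>M\<close> to
  \<open>M\<close> times the power with exponent \<open>M + I\<close>, and its \<open>r\<close>-th iterate on \<open>f\<close> is \<open>x^(r+1)\<close> times the
  \<open>r\<close>-th derivative of \<open>x^(r-1) f\<close>. Hence in the formulae for this operator the factor inside
  is \<open>x^A\<close>; it would be \<open>x^(A + (r-1) I)\<close> only for the operator \<open>x^(r+1) (d/dx)^r\<close>.
\<close>

definition sq_mderiv :: "(complex \<Rightarrow> complex^'d^'d) \<Rightarrow> complex \<Rightarrow> complex^'d^'d" where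
  "sq_mderiv f x = x\<^sup>2 *\<^sub>M mderiv f x"

end

theory Submission
  imports Defs "HOL-Complex_Analysis.Cauchy_Integral_Formula"
begin

text \<open>
  Write \<open>c(m,n) = (A)\<^sub>m\<^sub>-\<^sub>n (B)\<^sub>n (C)\<^sub>m\<^sup>-\<^sup>1\<close>, so that the Horn function is the double exponential series
  of \<open>c(m,n) x\<^sup>m y\<^sup>n / (m! n!)\<close>. Such a series makes differentiation trivial once the coefficients
  grow at most geometrically: \<open>\<partial>/\<partial>x\<close> and \<open>\<partial>/\<partial>y\<close> shift the indices \<open>m\<close> and \<open>n\<close> by one, and
  \<open>x \<partial>/\<partial>x\<close> and \<open>y \<partial>/\<partial>y\<close> multiply \<open>c(m,n)\<close> by \<open>m\<close> and \<open>n\<close>. The growth bound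
  (\<open>geometric_growth_h4_coeff\<close>) comes from estimating \<open>(M)\<^sub>n\<close> by \<open>K\<^sup>n n!\<close> and its inverse by
  \<open>K\<^sup>n/n!\<close>, and termwise differentiation from Weierstrass' theorem on uniform limits of
  holomorphic functions (\<open>has_mderiv_dexp_series_curve\<close>).

  What remains is algebra of Pochhammer symbols: peeling off the first factor of a symbol shifts its
  parameter by \<open>I\<close>, and peeling off the last one keeps it. The two plain derivatives use the first
  kind of identity. The derivatives of products with \<open>x\<^sup>A\<close>, \<open>y\<^sup>B\<close> or \<open>x\<^bsup>C - I\<^esup>\<close> produce
  \<open>A + (m-n)I\<close>, \<open>B + nI\<close> or \<open>C + (m-1)I\<close> as a factor of \<open>c(m,n)\<close>, which is the missing last
  factor of a symbol (\<open>h4_coeff_raise_A\<close>, \<open>h4_coeff_raise_B\<close>, \<open>h4_coeff_lower_C\<close>). Matrix powers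
  enter only through \<open>d/dx x\<^sup>M = M x\<^sup>M / x\<close> and \<open>x\<^bsup>M + I\<^esup> = x x\<^sup>M\<close>. This gives the five formulae
  for \<open>r = 1\<close>, and they iterate because each result is again of the form that was differentiated.
\<close>

section \<open>Matrix algebra\<close>

lemma cscale_nth [simp]: "(c *\<^sub>M M) $ i $ j = c * M $ i $ j"
  by (simp add: cscale_def)

lemma mat_add: "mat (a + b) = (mat a + mat b :: complex^'d^'d)"
  and mat_diff: "mat (a - b) = (mat a - mat b :: complex^'d^'d)"
  and mat_minus: "mat (- a) = (- mat a :: complex^'d^'d)"
  by (simp_all add: mat_def vec_eq_iff)

lemma mat_mult_left: "mat c ** M = c *\<^sub>M (M :: complex^'d^'d)"
  and mat_mult_right: "M ** mat c = c *\<^sub>M (M :: complex^'d^'d)"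
  by (simp_all add: mat_def matrix_matrix_mult_def vec_eq_iff if_distrib if_distribR
      mult.commute cong: if_cong)

lemma cscale_mult_left: "(c *\<^sub>M A) ** B = c *\<^sub>M (A ** (B :: complex^'d^'d))"
  and cscale_mult_right: "A ** (c *\<^sub>M B) = c *\<^sub>M (A ** (B :: complex^'d^'d))"
  by (simp_all add: matrix_matrix_mult_def vec_eq_iff sum_distrib_left algebra_simps)

lemma cscale_cscale [simp]: "a *\<^sub>M b *\<^sub>M M = (a * b) *\<^sub>M M"
  and cscale_one [simp]: "1 *\<^sub>M M = M"
  and cscale_zero [simp]: "0 *\<^sub>M M = 0" "a *\<^sub>M 0 = (0 :: complex^'d^'d)"
  and cscale_add_right: "a *\<^sub>M (M + N) = a *\<^sub>M M + a *\<^sub>M N"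
  and cscale_diff_right: "a *\<^sub>M (M - N) = a *\<^sub>M M - a *\<^sub>M N"
  and cscale_diff_left: "(a - b) *\<^sub>M M = a *\<^sub>M M - b *\<^sub>M M"
  and cscale_minus_left: "(- a) *\<^sub>M M = - (a *\<^sub>M M)"
  and cscale_minus_right: "a *\<^sub>M (- M) = - (a *\<^sub>M M)"
  by (simp_all add: vec_eq_iff algebra_simps)

lemma matrix_minus_left: "(- A) ** B = - (A ** (B :: complex^'d^'d))"
  and matrix_minus_right: "A ** (- B) = - (A ** (B :: complex^'d^'d))"
  and matrix_add_rdistrib: "(A + B) ** C = A ** C + B ** (C :: complex^'d^'d)"
  and matrix_diff_ldistrib: "A ** (B - C) = A ** B - A ** (C :: complex^'d^'d)"
  and matrix_diff_rdistrib: "(A - B) ** C = A ** C - B ** (C :: complex^'d^'d)"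
  by (simp_all add: matrix_matrix_mult_def vec_eq_iff sum_negf sum_subtractf sum.distrib algebra_simps)

lemmas matrix_distribs = matrix_add_ldistrib matrix_add_rdistrib matrix_diff_ldistrib
  matrix_diff_rdistrib matrix_minus_left matrix_minus_right cscale_mult_left cscale_mult_right
  mat_mult_left mat_mult_right cscale_add_right cscale_diff_right cscale_minus_left
  cscale_minus_right

definition commuting :: "complex^'d^'d \<Rightarrow> complex^'d^'d \<Rightarrow> bool" where
  "commuting A B \<longleftrightarrow> A ** B = B ** A"

lemma commuting_refl [simp]: "commuting A A"
  and commuting_sym: "commuting A B \<Longrightarrow> commuting B A"
  and commuting_mat [simp]: "commuting A (mat c)" "commuting (mat c) A"
  by (simp_all add: commuting_def mat_mult_left mat_mult_right)

lemma commuting_add: "commuting A B \<Longrightarrow> commuting A C \<Longrightarrow> commuting A (B + C)"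
  and commuting_diff: "commuting A B \<Longrightarrow> commuting A C \<Longrightarrow> commuting A (B - C)"
  and commuting_minus: "commuting A B \<Longrightarrow> commuting A (- B)"
  and commuting_cscale: "commuting A B \<Longrightarrow> commuting A (c *\<^sub>M B)"
  by (simp_all add: commuting_def matrix_distribs)

lemma commuting_mult: "commuting A B \<Longrightarrow> commuting A C \<Longrightarrow> commuting A (B ** C)"
  unfolding commuting_def by (metis matrix_mul_assoc)

lemma matrix_inv_right: "invertible A \<Longrightarrow> A ** matrix_inv A = mat 1"
  and matrix_inv_left: "invertible A \<Longrightarrow> matrix_inv A ** A = mat 1"
  for A :: "complex^'d^'d"
  unfolding invertible_def matrix_inv_def by (metis (mono_tags, lifting) someI_ex)+

lemma matrix_mult_right_cancel:
  fixes A B F :: "complex^'d^'d"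
  assumes "invertible F" "A ** F = B ** F"
  shows "A = B"
proof -
  have "A ** (F ** matrix_inv F) = B ** (F ** matrix_inv F)"
    using assms(2) by (simp add: matrix_mul_assoc)
  then show ?thesis
    using assms(1) by (simp add: matrix_inv_right)
qed

lemma matrix_inv_eqI:
  fixes A B :: "complex^'d^'d"
  assumes "A ** B = mat 1"
  shows "matrix_inv A = B"
proof -
  have "invertible A"
    using assms by (auto simp: invertible_right_inverse)
  then have "matrix_inv A ** (A ** B) = B"
    by (simp add: matrix_mul_assoc matrix_inv_left)
  then show ?thesis
    using assms by simp
qed

lemma matrix_inv_mult:
  fixes A B :: "complex^'d^'d"
  assumes "invertible A" "invertible B"
  shows "matrix_inv (A ** B) = matrix_inv B ** matrix_inv A"
proof (rule matrix_inv_eqI)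
  have "A ** B ** (matrix_inv B ** matrix_inv A) = A ** (B ** matrix_inv B) ** matrix_inv A"
    by (simp add: matrix_mul_assoc)
  then show "A ** B ** (matrix_inv B ** matrix_inv A) = mat 1"
    using assms by (simp add: matrix_inv_right)
qed

lemma matrix_inv_minus:
  fixes A :: "complex^'d^'d"
  assumes "invertible A"
  shows "matrix_inv (- A) = - matrix_inv A"
  using assms by (intro matrix_inv_eqI) (simp add: matrix_distribs matrix_inv_right)

lemma invertible_minus:
  fixes A :: "complex^'d^'d"
  assumes "invertible A"
  shows "invertible (- A)"
proof -
  have "(- A) ** (- matrix_inv A) = mat 1"
    using assms by (simp add: matrix_distribs matrix_inv_right)
  then show ?thesis
    by (auto simp: invertible_right_inverse)
qed

lemma matrix_inv_mat_1 [simp]: "matrix_inv (mat 1 :: complex^'d^'d) = mat 1"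
  by (rule matrix_inv_eqI) simp

lemma invertible_mat_1 [simp]: "invertible (mat 1 :: complex^'d^'d)"
  using invertible_def by fastforce

lemma commuting_inv:
  assumes "commuting A B" "invertible B"
  shows "commuting A (matrix_inv B)"
proof -
  have "matrix_inv B ** (A ** B) ** matrix_inv B = matrix_inv B ** (B ** A) ** matrix_inv B"
    using assms(1) by (simp add: commuting_def)
  then have "matrix_inv B ** A ** (B ** matrix_inv B) = (matrix_inv B ** B) ** A ** matrix_inv B"
    by (simp add: matrix_mul_assoc)
  then show ?thesis
    using assms(2) by (simp add: commuting_def matrix_inv_left matrix_inv_right)
qed

section \<open>The matrix Pochhammer symbol\<close>

lemma commuting_mpoch: "commuting X M \<Longrightarrow> commuting X (mpoch M n)"
  by (induction n) (auto intro!: commuting_mult commuting_add)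

lemma mpoch_Suc_left: "mpoch M (Suc n) = M ** mpoch (M + mat 1) n"
proof (induction n)
  case (Suc n)
  have "mpoch M (Suc (Suc n)) = M ** (mpoch (M + mat 1) n ** (M + mat (of_nat (Suc n))))"
    using Suc by (simp add: matrix_mul_assoc)
  then show ?case
    by (simp add: mat_add add.assoc)
qed simp

lemma invertible_mpoch:
  assumes "\<And>k. k < n \<Longrightarrow> invertible (M + mat (of_nat k))"
  shows "invertible (mpoch M n)"
  using assms by (induction n) (auto intro!: invertible_mult)

lemma invertible_neg_shift:
  fixes A :: "complex^'d^'d"
  assumes "\<And>k. k \<ge> 1 \<Longrightarrow> invertible (A - mat (of_nat k))"
  shows "invertible (mat 1 - A + mat (of_nat k))"
  using invertible_minus[OF assms[of "Suc k"]] by (simp add: mat_add algebra_simps)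

lemma commuting_mpoch_int:
  assumes "commuting X A" "\<And>k. k \<ge> 1 \<Longrightarrow> invertible (A - mat (of_nat k))"
  shows "commuting X (mpoch_int A k)"
proof -
  have "invertible (mpoch (mat 1 - A) n)" for n
    by (intro invertible_mpoch invertible_neg_shift) (rule assms(2))
  moreover have "commuting X (mat 1 - A)"
    using assms(1) by (intro commuting_diff) auto
  ultimately show ?thesis
    unfolding mpoch_int_def using assms(1)
    by (auto intro!: commuting_cscale commuting_inv commuting_mpoch)
qed

lemma mpoch_int_neg:
  assumes "n > 0"
  shows "mpoch_int A (- int n) = (-1) ^ n *\<^sub>M matrix_inv (mpoch (mat 1 - A) n)"
  using assms by (simp add: mpoch_int_def)

text \<open>The recurrence \<open>(A)\<^sub>k\<^sub>+\<^sub>1 = (A)\<^sub>k (A + kI)\<close> is the definition for \<open>k \<ge> 0\<close>. For \<open>k < 0\<close> it cancels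
  the last factor \<open>-(A + kI)\<close> of the Pochhammer symbol that is inverted in \<open>(A)\<^sub>k\<close>.\<close>

lemma mpoch_int_add_one:
  fixes A :: "complex^'d^'d"
  assumes "\<And>k. k \<ge> 1 \<Longrightarrow> invertible (A - mat (of_nat k))"
  shows "mpoch_int A (k + 1) = mpoch_int A k ** (A + mat (of_int k))"
proof (cases "k \<ge> 0")
  case True
  then show ?thesis
    by (simp add: mpoch_int_def nat_add_distrib)
next
  case False
  define n where "n = nat (- k - 1)"
  have k: "k = - int (Suc n)"
    using False by (simp add: n_def)
  let ?N = "mat 1 - A"
  have inv: "invertible (?N + mat (of_nat j))" for j
    by (rule invertible_neg_shift) (rule assms)
  have eq: "A + mat (of_int k) = - (?N + mat (of_nat n))"
    by (simp add: k mat_add mat_minus mat_diff algebra_simps)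
  have "mpoch_int A k ** (A + mat (of_int k))
      = (-1) ^ n *\<^sub>M (matrix_inv (mpoch ?N (Suc n)) ** (?N + mat (of_nat n)))"
    unfolding eq unfolding k
    by (subst mpoch_int_neg) (simp_all only: matrix_minus_right matrix_minus_left cscale_mult_left
        cscale_minus_left power_Suc mult_minus1 minus_minus zero_less_Suc)
  also have "mpoch ?N (Suc n) = (?N + mat (of_nat n)) ** mpoch ?N n"
  proof -
    have "commuting (?N + mat (of_nat n)) ?N"
      by (intro commuting_sym[OF commuting_add]) auto
    from commuting_mpoch[OF this] show ?thesis
      by (simp add: commuting_def)
  qed
  also have "matrix_inv \<dots> = matrix_inv (mpoch ?N n) ** matrix_inv (?N + mat (of_nat n))"
    by (intro matrix_inv_mult inv invertible_mpoch)
  also have "\<dots> ** (?N + mat (of_nat n)) = matrix_inv (mpoch ?N n)"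
    using inv[of n] by (simp flip: matrix_mul_assoc add: matrix_inv_left)
  also have "(-1) ^ n *\<^sub>M matrix_inv (mpoch ?N n) = mpoch_int A (k + 1)"
    unfolding k by (cases "n = 0") (auto simp: mpoch_int_def)
  finally show ?thesis ..
qed

text \<open>Peeling off the first factor instead follows by induction on the index, in both directions,
  from peeling off the last one; going down, a factor \<open>A + kI\<close> with \<open>k \<le> 0\<close> has to be cancelled.\<close>

lemma mpoch_int_shift:
  fixes A :: "complex^'d^'d"
  assumes A: "\<And>k. k \<ge> 1 \<Longrightarrow> invertible (A - mat (of_nat k))" and "invertible A"
  shows "mpoch_int A (k + 1) = A ** mpoch_int (A + mat 1) k"
proof -
  have A1: "invertible (A + mat 1 - mat (of_nat k))" if "k \<ge> 1" for k
  proof (cases "k = 1")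
    case False
    then show ?thesis
      using A[of "k - 1"] that by (simp add: of_nat_diff mat_diff algebra_simps)
  qed (use \<open>invertible A\<close> in simp)
  show ?thesis
  proof (induction k rule: int_induct[where k = 0])
    case base
    show ?case
      by (simp add: mpoch_int_def)
  next
    case (step1 k)
    then show ?case
      using mpoch_int_add_one[of A "k + 1", OF A] mpoch_int_add_one[of "A + mat 1" k, OF A1]
      by (simp add: mat_add matrix_mul_assoc algebra_simps)
  next
    case (step2 k)
    let ?F = "A + mat (of_int k)"
    have F: "invertible ?F"
    proof (cases "k = 0")
      case False
      then have "?F = A - mat (of_nat (nat (- k)))"
        using step2 by (simp add: mat_minus)
      then show ?thesis
        using A[of "nat (- k)"] False step2 by simp
    qed (use \<open>invertible A\<close> in simp)
    have "mpoch_int A k ** ?F = A ** mpoch_int (A + mat 1) (k - 1) ** ?F"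
      using step2 mpoch_int_add_one[of A k, OF A] mpoch_int_add_one[of "A + mat 1" "k - 1", OF A1]
      by (simp add: mat_diff matrix_mul_assoc)
    then show ?case
      using matrix_mult_right_cancel[OF F] by simp
  qed
qed

section \<open>Matrix norms and growth of Pochhammer symbols\<close>

lemma norm_nth_nth_le: "norm (M $ i $ j) \<le> norm (M :: complex^'d^'d)"
  by (metis Finite_Cartesian_Product.norm_nth_le order_trans)

lemma norm_matrix_square:
  "(norm M)\<^sup>2 = (\<Sum>i\<in>UNIV. \<Sum>j\<in>UNIV. (norm (M $ i $ j))\<^sup>2)" for M :: "complex^'d^'d"
  by (simp add: norm_vec_def L2_set_def sum_nonneg)

text \<open>The norm of the type is the Frobenius norm; Cauchy--Schwarz bounds each entry of a product.\<close>

lemma norm_matrix_mult_le: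
  fixes A B :: "complex^'d^'d"
  shows "norm (A ** B) \<le> norm A * norm B"
proof -
  note sq = norm_matrix_square
  have entry: "(norm ((A ** B) $ i $ j))\<^sup>2
      \<le> (\<Sum>k\<in>UNIV. (norm (A $ i $ k))\<^sup>2) * (\<Sum>k\<in>UNIV. (norm (B $ k $ j))\<^sup>2)" for i j
  proof -
    have "norm ((A ** B) $ i $ j) \<le> (\<Sum>k\<in>UNIV. norm (A $ i $ k) * norm (B $ k $ j))"
      unfolding matrix_matrix_mult_def by (auto intro!: order_trans[OF norm_sum] simp: norm_mult)
    also have "\<dots> \<le> L2_set (\<lambda>k. norm (A $ i $ k)) UNIV * L2_set (\<lambda>k. norm (B $ k $ j)) UNIV"
      using L2_set_mult_ineq[of "\<lambda>k. norm (A $ i $ k)" "\<lambda>k. norm (B $ k $ j)" UNIV] by simp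
    finally have "(norm ((A ** B) $ i $ j))\<^sup>2
        \<le> (L2_set (\<lambda>k. norm (A $ i $ k)) UNIV * L2_set (\<lambda>k. norm (B $ k $ j)) UNIV)\<^sup>2"
      by (rule power_mono) simp
    then show ?thesis
      by (simp add: L2_set_def power_mult_distrib sum_nonneg)
  qed
  have "(norm (A ** B))\<^sup>2 \<le> (\<Sum>i\<in>UNIV. \<Sum>j\<in>UNIV.
      (\<Sum>k\<in>UNIV. (norm (A $ i $ k))\<^sup>2) * (\<Sum>k\<in>UNIV. (norm (B $ k $ j))\<^sup>2))"
    unfolding sq by (intro sum_mono entry)
  also have "\<dots> = (norm A)\<^sup>2 * (norm B)\<^sup>2"
  proof -
    have "(norm B)\<^sup>2 = (\<Sum>j\<in>UNIV. \<Sum>k\<in>UNIV. (norm (B $ k $ j))\<^sup>2)"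
      unfolding sq by (rule sum.swap)
    then show ?thesis
      by (simp add: sq[of A] sum_product)
  qed
  finally show ?thesis
    by (metis power2_le_imp_le power_mult_distrib mult_nonneg_nonneg norm_ge_zero)
qed

lemma norm_cscale: "norm (c *\<^sub>M M) = norm c * norm (M :: complex^'d^'d)"
proof (rule power2_eq_imp_eq)
  show "(norm (c *\<^sub>M M))\<^sup>2 = (norm c * norm M)\<^sup>2"
    by (simp add: norm_matrix_square power_mult_distrib norm_mult sum_distrib_left)
qed simp_all

lemma norm_mat: "norm (mat c :: complex^'d^'d) = norm c * norm (mat 1 :: complex^'d^'d)"
proof -
  have "mat c = c *\<^sub>M (mat 1 :: complex^'d^'d)"
    using mat_mult_left[of c "mat 1 :: complex^'d^'d"] by (simp only: matrix_mul_rid)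
  then show ?thesis
    by (metis norm_cscale)
qed

lemma bounded_linear_nth_nth: "bounded_linear (\<lambda>M :: complex^'d^'d. M $ i $ j)"
  by (intro bounded_linear_compose[OF bounded_linear_vec_nth bounded_linear_vec_nth])

lemma bounded_linear_matrix_sandwich:
  fixes P Q :: "complex^'d^'d"
  shows "bounded_linear (\<lambda>M. P ** M ** Q)"
proof (rule bounded_linear_intro)
  show "P ** (M + N) ** Q = P ** M ** Q + P ** N ** Q" for M N
    by (simp add: matrix_distribs)
  show "P ** (r *\<^sub>R M) ** Q = r *\<^sub>R (P ** M ** Q)" for r M
  proof -
    have "r *\<^sub>R N = of_real r *\<^sub>M N" for N :: "complex^'d^'d"
      by (simp add: vec_eq_iff scaleR_conv_of_real[where 'a = complex])
    then show ?thesis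
      by (simp add: matrix_distribs)
  qed
  show "norm (P ** M ** Q) \<le> norm M * (norm P * norm Q)" for M
  proof -
    have "norm (P ** M ** Q) \<le> norm (P ** M) * norm Q"
      by (rule norm_matrix_mult_le)
    also have "\<dots> \<le> (norm P * norm M) * norm Q"
      by (intro mult_right_mono norm_matrix_mult_le) simp
    finally show ?thesis
      by (simp add: mult_ac)
  qed
qed

lemma norm_add_mat_le:
  fixes M :: "complex^'d^'d"
  shows "norm (M + mat (of_nat k)) \<le> (norm M + norm (mat 1 :: complex^'d^'d)) * real (Suc k)"
proof -
  have "norm (M + mat (of_nat k)) \<le> norm M + real k * norm (mat 1 :: complex^'d^'d)"
    using norm_triangle_ineq[of M "mat (of_nat k)"] norm_mat[of "of_nat k", where 'd = 'd]
    by simp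
  also have "\<dots> \<le> (norm M + norm (mat 1 :: complex^'d^'d)) * real (Suc k)"
    by (simp add: algebra_simps)
  finally show ?thesis .
qed

lemma mpoch_growth:
  fixes M :: "complex^'d^'d"
  obtains K where "K \<ge> 1" "\<And>n. norm (mpoch M n) \<le> K ^ Suc n * fact n"
proof
  define K where "K = 1 + norm M + norm (mat 1 :: complex^'d^'d)"
  show "K \<ge> 1"
    by (simp add: K_def)
  show "norm (mpoch M n) \<le> K ^ Suc n * fact n" for n
  proof (induction n)
    case (Suc n)
    have "norm (mpoch M (Suc n)) \<le> norm (mpoch M n) * norm (M + mat (of_nat n))"
      by (simp add: norm_matrix_mult_le)
    also have "\<dots> \<le> (K ^ Suc n * fact n) * (K * real (Suc n))"
    proof (intro mult_mono Suc)
      show "norm (M + mat (of_nat n)) \<le> K * real (Suc n)"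
        by (rule order_trans[OF norm_add_mat_le]) (simp add: K_def)
    qed (use \<open>K \<ge> 1\<close> in auto)
    finally show ?case
      by (simp add: algebra_simps)
  qed (simp add: K_def)
qed

text \<open>For large \<open>k\<close> the matrix \<open>M + kI\<close> is dominated by \<open>kI\<close>: from \<open>k X = I - X M\<close> for
  \<open>X = (M + kI)\<^sup>-\<^sup>1\<close> one gets \<open>(k - \<parallel>M\<parallel>) \<parallel>X\<parallel> \<le> \<parallel>I\<parallel>\<close>.\<close>

lemma norm_inv_add_mat_le:
  fixes M :: "complex^'d^'d"
  assumes "\<And>k. invertible (M + mat (of_nat k))"
  obtains K where "\<And>k. norm (matrix_inv (M + mat (of_nat k))) \<le> K / real (Suc k)"
proof -
  define X where "X k = matrix_inv (M + mat (of_nat k))" for k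
  have bound: "(real k - norm M) * norm (X k) \<le> norm (mat 1 :: complex^'d^'d)" for k
  proof -
    have "X k ** M + of_nat k *\<^sub>M X k = mat 1"
      using matrix_inv_left[OF assms[of k]] by (simp add: X_def matrix_distribs)
    then have "of_nat k *\<^sub>M X k = mat 1 - X k ** M"
      by (simp add: algebra_simps)
    then have "real k * norm (X k) \<le> norm (mat 1 :: complex^'d^'d) + norm (X k ** M)"
      using norm_triangle_ineq4[of "mat 1" "X k ** M"] norm_cscale[of "of_nat k" "X k"] by simp
    then show ?thesis
      using norm_matrix_mult_le[of "X k" M] by (simp add: algebra_simps)
  qed
  obtain N where N: "real N \<ge> 2 * norm M + 1"
    using real_arch_simple by blast
  have "Bseq (\<lambda>k. real (Suc k) * norm (X k))"
  proof (rule BfunI)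
    show "\<forall>\<^sub>F k in sequentially. norm (real (Suc k) * norm (X k)) \<le> 4 * norm (mat 1 :: complex^'d^'d)"
    proof (rule eventually_sequentiallyI)
      fix k assume "k \<ge> N"
      then have "real k \<ge> 2 * norm M + 1"
        using N by simp
      then have "real (Suc k) \<le> 4 * (real k - norm M)"
        using norm_ge_zero[of M] by simp
      then have "real (Suc k) * norm (X k) \<le> 4 * ((real k - norm M) * norm (X k))"
        by (subst mult.assoc[symmetric], intro mult_right_mono) auto
      also have "\<dots> \<le> 4 * norm (mat 1 :: complex^'d^'d)"
        using bound[of k] by simp
      finally show "norm (real (Suc k) * norm (X k)) \<le> 4 * norm (mat 1 :: complex^'d^'d)"
        by (simp add: abs_mult)
    qed
  qed
  then obtain K where "\<And>k. real (Suc k) * norm (X k) \<le> K"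
    unfolding Bseq_def by auto
  then have "norm (X k) \<le> K / real (Suc k)" for k
    by (simp add: field_simps)
  then show thesis
    using that unfolding X_def by blast
qed

lemma mpoch_inv_growth:
  fixes M :: "complex^'d^'d"
  assumes "\<And>k. invertible (M + mat (of_nat k))"
  obtains K where "K \<ge> 1" "\<And>n. norm (matrix_inv (mpoch M n)) \<le> K ^ Suc n / fact n"
proof -
  obtain L where L: "norm (matrix_inv (M + mat (of_nat k))) \<le> L / real (Suc k)" for k
    using norm_inv_add_mat_le[OF assms] by metis
  have "L \<le> 1 + \<bar>L\<bar> + norm (mat 1 :: complex^'d^'d)"
    using abs_ge_self[of L] norm_ge_zero[of "mat 1 :: complex^'d^'d"] by linarith
  then obtain K where K: "K = 1 + \<bar>L\<bar> + norm (mat 1 :: complex^'d^'d)" "L \<le> K"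
    by simp
  have "norm (matrix_inv (mpoch M n)) \<le> K ^ Suc n / fact n" for n
  proof (induction n)
    case (Suc n)
    have "matrix_inv (mpoch M (Suc n)) = matrix_inv (M + mat (of_nat n)) ** matrix_inv (mpoch M n)"
      by (simp add: matrix_inv_mult invertible_mpoch assms)
    also have "norm \<dots> \<le> norm (matrix_inv (M + mat (of_nat n))) * norm (matrix_inv (mpoch M n))"
      by (rule norm_matrix_mult_le)
    also have "\<dots> \<le> (K / real (Suc n)) * (K ^ Suc n / fact n)"
    proof (intro mult_mono Suc)
      show "norm (matrix_inv (M + mat (of_nat n))) \<le> K / real (Suc n)"
        by (rule order_trans[OF L]) (intro divide_right_mono K, simp)
    qed (auto simp: K)
    finally show ?case
      by (simp add: algebra_simps)
  qed (simp add: K)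
  then show thesis
    by (intro that[of K]) (auto simp: K)
qed

section \<open>Double exponential series\<close>

text \<open>The hypothesis under which all analytic steps go through: at most geometric coefficients, so that
  the factorials make the series below converge absolutely and locally uniformly on the whole of
  \<open>\<complex>\<^sup>2\<close>. It is preserved by shifts and by multiplication with the indices or with constant
  matrices.\<close>

definition geometric_growth :: "(nat \<Rightarrow> nat \<Rightarrow> complex^'d^'d) \<Rightarrow> bool" where
  "geometric_growth c \<longleftrightarrow> (\<exists>D K. D \<ge> 0 \<and> K \<ge> 1 \<and> (\<forall>m n. norm (c m n) \<le> D * K ^ (m + n)))"

definition dexp_series :: "(nat \<Rightarrow> nat \<Rightarrow> complex^'d^'d) \<Rightarrow> complex \<Rightarrow> complex \<Rightarrow> complex^'d^'d" where
  "dexp_series c x y = (\<Sum>\<^sub>\<infinity>(m, n)\<in>UNIV. (x ^ m * y ^ n / (fact m * fact n)) *\<^sub>M c m n)"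

lemma geometric_growthI:
  assumes "D \<ge> 0" "K \<ge> 1" "\<And>m n. norm (c m n) \<le> D * K ^ (m + n)"
  shows "geometric_growth c"
  using assms unfolding geometric_growth_def by blast

lemma geometric_growthE:
  assumes "geometric_growth c"
  obtains D K where "D \<ge> 0" "K \<ge> 1" "\<And>m n. norm (c m n) \<le> D * K ^ (m + n)"
  using assms unfolding geometric_growth_def by blast

lemma geometric_growth_shift_fst:
  assumes "geometric_growth c"
  shows "geometric_growth (\<lambda>m n. c (Suc m) n)"
  using assms
proof (rule geometric_growthE)
  fix D K :: real
  assume "D \<ge> 0" "K \<ge> 1" and c: "\<And>m n. norm (c m n) \<le> D * K ^ (m + n)"
  then show ?thesis
    using c[of "Suc _"] by (intro geometric_growthI[of "D * K" K]) (auto simp: mult.assoc)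
qed

lemma geometric_growth_shift_snd:
  assumes "geometric_growth c"
  shows "geometric_growth (\<lambda>m n. c m (Suc n))"
  using assms
proof (rule geometric_growthE)
  fix D K :: real
  assume "D \<ge> 0" "K \<ge> 1" and c: "\<And>m n. norm (c m n) \<le> D * K ^ (m + n)"
  then show ?thesis
    using c[of _ "Suc _"] by (intro geometric_growthI[of "D * K" K]) (auto simp: mult.assoc)
qed

lemma geometric_growth_scale:
  assumes "geometric_growth c" and q: "\<And>m n. norm (q m n) \<le> 2 ^ (m + n)"
  shows "geometric_growth (\<lambda>m n. q m n *\<^sub>M c m n)"
  using assms(1)
proof (rule geometric_growthE)
  fix D K :: real
  assume DK: "D \<ge> 0" "K \<ge> 1" and c: "\<And>m n. norm (c m n) \<le> D * K ^ (m + n)"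
  have "norm (q m n *\<^sub>M c m n) \<le> D * (2 * K) ^ (m + n)" for m n
    using mult_mono[OF q[of m n] c[of m n]] DK by (simp add: norm_cscale power_mult_distrib mult_ac)
  then show ?thesis
    using DK by (intro geometric_growthI[of D "2 * K"]) auto
qed

text \<open>The Euler operators \<open>x \<partial>/\<partial>x\<close> and \<open>y \<partial>/\<partial>y\<close> multiply the coefficients by the indices, which are
  dominated by powers of 2.\<close>

lemma geometric_growth_euler:
  assumes "geometric_growth c"
  shows "geometric_growth (\<lambda>m n. of_nat m *\<^sub>M c m n)" "geometric_growth (\<lambda>m n. of_nat n *\<^sub>M c m n)"
proof -
  have "real m \<le> 2 ^ (m + n)" "real n \<le> 2 ^ (m + n)" for m n :: nat
    using of_nat_less_two_power[of "m + n", where 'a = real] by linarith+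
  then show "geometric_growth (\<lambda>m n. of_nat m *\<^sub>M c m n)" "geometric_growth (\<lambda>m n. of_nat n *\<^sub>M c m n)"
    by (auto intro!: geometric_growth_scale assms)
qed

lemma geometric_growth_sandwich:
  fixes P Q :: "complex^'d^'d"
  assumes "geometric_growth c"
  shows "geometric_growth (\<lambda>m n. P ** c m n ** Q)"
  using assms
proof (rule geometric_growthE)
  fix D K :: real
  assume DK: "D \<ge> 0" "K \<ge> 1" and c: "\<And>m n. norm (c m n) \<le> D * K ^ (m + n)"
  obtain L where L: "L \<ge> 0" "\<And>M. norm (P ** M ** Q) \<le> norm M * L"
    using bounded_linear.nonneg_bounded[OF bounded_linear_matrix_sandwich[of P Q]] by blast
  have "norm (P ** c m n ** Q) \<le> D * L * K ^ (m + n)" for m n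
    using order_trans[OF L(2) mult_right_mono[OF c[of m n] L(1)]] by (simp add: mult_ac)
  then show ?thesis
    using DK L by (intro geometric_growthI[of "D * L" K]) auto
qed

lemma geometric_growth_mult_left: "geometric_growth c \<Longrightarrow> geometric_growth (\<lambda>m n. P ** c m n)"
  using geometric_growth_sandwich[of c P "mat 1"] by simp

lemma geometric_growth_mult_right: "geometric_growth c \<Longrightarrow> geometric_growth (\<lambda>m n. c m n ** Q)"
  using geometric_growth_sandwich[of c "mat 1" Q] by simp

lemma dexp_majorant_summable:
  fixes a b :: real
  assumes "D \<ge> 0" "a \<ge> 0" "b \<ge> 0"
  shows "(\<lambda>(m, n). D * (a ^ m / fact m * (b ^ n / fact n))) summable_on UNIV"
proof -
  have exp: "((\<lambda>n. r ^ n / fact n) has_sum exp r) UNIV" if "r \<ge> 0" for r :: real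
    using exp_converges[of r] that
    by (intro sums_nonneg_imp_has_sum) (auto simp: divide_inverse mult.commute)
  have "(\<lambda>(m, n). D * (a ^ m / fact m * (b ^ n / fact n))) summable_on Sigma UNIV (\<lambda>_. UNIV)"
  proof (rule summable_on_SigmaI)
    show "((\<lambda>n. case (m, n) of (m, n) \<Rightarrow> D * (a ^ m / fact m * (b ^ n / fact n)))
        has_sum D * (a ^ m / fact m * exp b)) UNIV" for m
      unfolding prod.case by (intro has_sum_cmult_right exp assms)
    show "(\<lambda>m. D * (a ^ m / fact m * exp b)) summable_on UNIV"
      using assms exp[of a]
      by (intro summable_on_cmult_right summable_on_cmult_left) (auto simp: summable_on_def)
  qed (use assms in auto)
  then show ?thesis
    by simp
qed

text \<open>The majorant depends on \<open>x\<close> and \<open>y\<close> only through \<open>R\<close>: it serves for absolute convergence at a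
  point and for the uniform convergence on a disc that differentiation needs.\<close>

lemma dexp_term_bound:
  fixes x y :: complex
  assumes "norm x \<le> R" "norm y \<le> R" "norm C \<le> D * K ^ (m + n)"
  shows "norm (x ^ m * y ^ n / (fact m * fact n)) * norm C
    \<le> D * ((K * R) ^ m / fact m * ((K * R) ^ n / fact n))"
proof -
  have "norm (x ^ m * y ^ n) * norm C \<le> (R ^ m * R ^ n) * (D * K ^ (m + n))"
    unfolding norm_mult norm_power using assms norm_ge_zero[of x] order_trans[OF norm_ge_zero assms(1)]
    by (intro mult_mono power_mono mult_nonneg_nonneg zero_le_power norm_ge_zero) auto
  then show ?thesis
    by (simp add: norm_divide norm_mult divide_right_mono power_mult_distrib power_add field_simps)
qed

lemma has_sum_dexp_series:
  assumes "geometric_growth c"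
  shows "((\<lambda>(m, n). (x ^ m * y ^ n / (fact m * fact n)) *\<^sub>M c m n) has_sum dexp_series c x y) UNIV"
  using assms
proof (rule geometric_growthE)
  fix D K :: real
  assume DK: "D \<ge> 0" "K \<ge> 1" and c: "\<And>m n. norm (c m n) \<le> D * K ^ (m + n)"
  define R where "R = max (norm x) (norm y)"
  have "(\<lambda>p. norm (case p of (m, n) \<Rightarrow> (x ^ m * y ^ n / (fact m * fact n)) *\<^sub>M c m n)) summable_on UNIV"
  proof (rule Infinite_Sum.abs_summable_on_comparison_test')
    show "(\<lambda>(m, n). D * ((K * R) ^ m / fact m * ((K * R) ^ n / fact n))) summable_on UNIV"
      using DK by (intro dexp_majorant_summable) (auto simp: R_def le_max_iff_disj)
    show "norm (case p of (m, n) \<Rightarrow> (x ^ m * y ^ n / (fact m * fact n)) *\<^sub>M c m n)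
        \<le> (case p of (m, n) \<Rightarrow> D * ((K * R) ^ m / fact m * ((K * R) ^ n / fact n)))" for p
    proof (cases p)
      case (Pair m n)
      show ?thesis
        unfolding Pair prod.case norm_cscale by (rule dexp_term_bound) (auto simp: R_def c)
    qed
  qed
  then show ?thesis
    unfolding dexp_series_def by (rule has_sum_infsum[OF abs_summable_summable])
qed

lemma dexp_series_eqI:
  assumes "((\<lambda>(m, n). (x ^ m * y ^ n / (fact m * fact n)) *\<^sub>M c m n) has_sum S) UNIV"
  shows "dexp_series c x y = S"
  unfolding dexp_series_def by (rule infsumI[OF assms])

lemma has_sum_dexp_series_nth:
  assumes "geometric_growth c"
  shows "((\<lambda>(m, n). x ^ m * y ^ n / (fact m * fact n) * c m n $ i $ j)
    has_sum dexp_series c x y $ i $ j) UNIV"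
  using has_sum_bounded_linear[OF bounded_linear_nth_nth has_sum_dexp_series[OF assms]]
  by (simp add: case_prod_unfold)

lemma dexp_series_sandwich:
  fixes P Q :: "complex^'d^'d"
  assumes "geometric_growth c"
  shows "dexp_series (\<lambda>m n. P ** c m n ** Q) x y = P ** dexp_series c x y ** Q"
  using has_sum_bounded_linear[OF bounded_linear_matrix_sandwich[of P Q] has_sum_dexp_series[OF assms, of x y]]
  by (intro dexp_series_eqI) (simp add: case_prod_unfold matrix_distribs)

lemma dexp_series_mult_left:
  assumes "geometric_growth c"
  shows "dexp_series (\<lambda>m n. P ** c m n) x y = P ** dexp_series c x y"
  using dexp_series_sandwich[OF assms, of P "mat 1"] by simp

lemma dexp_series_mult_right:
  assumes "geometric_growth c"
  shows "dexp_series (\<lambda>m n. c m n ** Q) x y = dexp_series c x y ** Q"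
  using dexp_series_sandwich[OF assms, of "mat 1" Q] by simp

lemma dexp_series_add:
  assumes "geometric_growth c" "geometric_growth d"
  shows "dexp_series (\<lambda>m n. c m n + d m n) x y = dexp_series c x y + dexp_series d x y"
  using has_sum_add[OF has_sum_dexp_series[OF assms(1), of x y] has_sum_dexp_series[OF assms(2), of x y]]
  by (intro dexp_series_eqI) (simp add: case_prod_unfold cscale_add_right)

lemma dexp_series_minus:
  assumes "geometric_growth c"
  shows "dexp_series (\<lambda>m n. - c m n) x y = - dexp_series c x y"
  using dexp_series_mult_left[OF assms, of "- mat 1"] by (simp add: matrix_minus_left)

text \<open>Differentiating a power series kills the terms of index 0; this is the reindexing that follows.\<close>

lemma has_sum_shift_fst:
  fixes g :: "nat \<Rightarrow> nat \<Rightarrow> 'a :: {comm_monoid_add, topological_space}"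
  assumes "\<And>n. g 0 n = 0" "((\<lambda>(m, n). g (Suc m) n) has_sum S) UNIV"
  shows "((\<lambda>(m, n). g m n) has_sum S) UNIV"
proof -
  have "((\<lambda>(m, n). g (Suc m) n) has_sum S) UNIV \<longleftrightarrow> ((\<lambda>(m, n). g m n) has_sum S) ({0<..} \<times> UNIV)"
    by (rule has_sum_reindex_bij_witness[of _ "\<lambda>(m, n). (m - 1, n)" "\<lambda>(m, n). (Suc m, n)"]) auto
  also have "\<dots> \<longleftrightarrow> ((\<lambda>(m, n). g m n) has_sum S) UNIV"
    by (rule has_sum_cong_neutral) (use assms(1) in \<open>auto intro!: gr0I\<close>)
  finally show ?thesis
    using assms(2) by simp
qed

lemma has_sum_shift_snd:
  fixes g :: "nat \<Rightarrow> nat \<Rightarrow> 'a :: {comm_monoid_add, topological_space}"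
  assumes "\<And>m. g m 0 = 0" "((\<lambda>(m, n). g m (Suc n)) has_sum S) UNIV"
  shows "((\<lambda>(m, n). g m n) has_sum S) UNIV"
proof -
  have "((\<lambda>(m, n). g m (Suc n)) has_sum S) UNIV \<longleftrightarrow> ((\<lambda>(m, n). g m n) has_sum S) (UNIV \<times> {0<..})"
    by (rule has_sum_reindex_bij_witness[of _ "\<lambda>(m, n). (m, n - 1)" "\<lambda>(m, n). (m, Suc n)"]) auto
  also have "\<dots> \<longleftrightarrow> ((\<lambda>(m, n). g m n) has_sum S) UNIV"
    by (rule has_sum_cong_neutral) (use assms(1) in \<open>auto intro!: gr0I\<close>)
  finally show ?thesis
    using assms(2) by simp
qed

lemma of_nat_Suc_over_fact: "of_nat (Suc n) / fact (Suc n) = (1 / fact n :: complex)"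
  by (simp add: fact_Suc del: of_nat_Suc)

text \<open>This is \<open>x \<partial>/\<partial>x\<close> applied term by term: the partial derivative shifts the coefficients, and the
  factor \<open>x\<close> restores the old exponent, so that \<open>x\<^sup>m/m!\<close> reappears with the factor \<open>m\<close>. It turns
  factors \<open>x\<close> and \<open>y\<close> in front of a series into a change of coefficients.\<close>

lemma dexp_series_euler_fst:
  assumes "geometric_growth c"
  shows "dexp_series (\<lambda>m n. of_nat m *\<^sub>M c m n) x y = x *\<^sub>M dexp_series (\<lambda>m n. c (Suc m) n) x y"
proof (rule dexp_series_eqI, rule has_sum_shift_fst)
  note bl = bounded_linear_matrix_sandwich[of "mat x" "mat 1"]
  have "((\<lambda>(m, n). x *\<^sub>M (x ^ m * y ^ n / (fact m * fact n)) *\<^sub>M c (Suc m) n)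
      has_sum x *\<^sub>M dexp_series (\<lambda>m n. c (Suc m) n) x y) UNIV"
    using has_sum_bounded_linear[OF bl has_sum_dexp_series[OF geometric_growth_shift_fst[OF assms]]]
    by (simp add: case_prod_unfold mat_mult_left)
  moreover have "x * (x ^ m * y ^ n / (fact m * fact n))
      = x ^ Suc m * y ^ n / (fact (Suc m) * fact n) * of_nat (Suc m)" for m n
    using of_nat_Suc_over_fact[of m] by (simp add: divide_simps del: of_nat_Suc)
  ultimately show "((\<lambda>(m, n). (x ^ Suc m * y ^ n / (fact (Suc m) * fact n)) *\<^sub>M
      of_nat (Suc m) *\<^sub>M c (Suc m) n) has_sum x *\<^sub>M dexp_series (\<lambda>m n. c (Suc m) n) x y) UNIV"
    by (simp only: cscale_cscale)
qed simp

lemma dexp_series_euler_snd: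
  assumes "geometric_growth c"
  shows "dexp_series (\<lambda>m n. of_nat n *\<^sub>M c m n) x y = y *\<^sub>M dexp_series (\<lambda>m n. c m (Suc n)) x y"
proof (rule dexp_series_eqI, rule has_sum_shift_snd)
  note bl = bounded_linear_matrix_sandwich[of "mat y" "mat 1"]
  have "((\<lambda>(m, n). y *\<^sub>M (x ^ m * y ^ n / (fact m * fact n)) *\<^sub>M c m (Suc n))
      has_sum y *\<^sub>M dexp_series (\<lambda>m n. c m (Suc n)) x y) UNIV"
    using has_sum_bounded_linear[OF bl has_sum_dexp_series[OF geometric_growth_shift_snd[OF assms]]]
    by (simp add: case_prod_unfold mat_mult_left)
  moreover have "y * (x ^ m * y ^ n / (fact m * fact n))
      = x ^ m * y ^ Suc n / (fact m * fact (Suc n)) * of_nat (Suc n)" for m n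
    using of_nat_Suc_over_fact[of n] by (simp add: divide_simps del: of_nat_Suc)
  ultimately show "((\<lambda>(m, n). (x ^ m * y ^ Suc n / (fact m * fact (Suc n))) *\<^sub>M
      of_nat (Suc n) *\<^sub>M c m (Suc n)) has_sum y *\<^sub>M dexp_series (\<lambda>m n. c m (Suc n)) x y) UNIV"
    by (simp only: cscale_cscale)
qed simp

section \<open>Differentiation\<close>

text \<open>The relational counterpart of \<^const>\<open>mderiv\<close>: it also asserts that the derivative exists, which the
  product rule needs.\<close>

definition has_mderiv :: "(complex \<Rightarrow> complex^'d^'d) \<Rightarrow> complex^'d^'d \<Rightarrow> complex \<Rightarrow> bool" where
  "has_mderiv f F x \<longleftrightarrow> (\<forall>i j. ((\<lambda>t. f t $ i $ j) has_field_derivative F $ i $ j) (at x))"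

lemma mderiv_eq: "has_mderiv f F x \<Longrightarrow> mderiv f x = F"
  by (simp add: has_mderiv_def mderiv_def vec_eq_iff DERIV_imp_deriv)

lemma has_mderiv_cong_open:
  assumes "has_mderiv g F x" "open S" "x \<in> S" "\<And>t. t \<in> S \<Longrightarrow> f t = g t"
  shows "has_mderiv f F x"
  unfolding has_mderiv_def
proof (intro allI)
  fix i j
  show "((\<lambda>t. f t $ i $ j) has_field_derivative F $ i $ j) (at x)"
  proof (rule has_field_derivative_transform_within_open)
    show "((\<lambda>t. g t $ i $ j) has_field_derivative F $ i $ j) (at x)"
      using assms(1) by (simp add: has_mderiv_def)
    show "g t $ i $ j = f t $ i $ j" if "t \<in> S" for t
      using assms(4)[OF that] by simp
  qed (fact assms)+
qed

lemma has_mderiv_const: "has_mderiv (\<lambda>_. M) 0 x"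
  by (simp add: has_mderiv_def)

lemma has_mderiv_cscale:
  assumes "(u has_field_derivative u') (at x)" "has_mderiv f F x"
  shows "has_mderiv (\<lambda>t. u t *\<^sub>M f t) (u' *\<^sub>M f x + u x *\<^sub>M F) x"
  using assms by (auto simp: has_mderiv_def intro!: derivative_eq_intros)

lemma has_mderiv_mult:
  assumes "has_mderiv f F x" "has_mderiv g G x"
  shows "has_mderiv (\<lambda>t. f t ** g t) (F ** g x + f x ** G) x"
  unfolding has_mderiv_def
proof (intro allI)
  fix i j
  have "((\<lambda>t. \<Sum>k\<in>UNIV. f t $ i $ k * g t $ k $ j) has_field_derivative
      (\<Sum>k\<in>UNIV. F $ i $ k * g x $ k $ j + G $ k $ j * f x $ i $ k)) (at x)"
    using assms by (intro DERIV_sum DERIV_mult) (auto simp: has_mderiv_def)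
  then show "((\<lambda>t. (f t ** g t) $ i $ j) has_field_derivative (F ** g x + f x ** G) $ i $ j) (at x)"
    by (simp add: matrix_matrix_mult_def sum.distrib mult.commute)
qed

lemma has_mderiv_mult_left: "has_mderiv f F x \<Longrightarrow> has_mderiv (\<lambda>t. P ** f t) (P ** F) x"
  using has_mderiv_mult[OF has_mderiv_const] by fastforce

lemma has_mderiv_mult_right: "has_mderiv f F x \<Longrightarrow> has_mderiv (\<lambda>t. f t ** Q) (F ** Q) x"
  using has_mderiv_mult[OF _ has_mderiv_const] by fastforce

text \<open>A derivative along a curve rather than two partial derivatives, because \<open>(x, y/x)\<close> moves both
  arguments at once. On a small disc both curves are bounded, so that the series converges there uniformly; by
  Weierstrass it may be differentiated term by term, and the two halves of the product rule are
  the two shifted series.\<close>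

lemma has_mderiv_dexp_series_curve:
  assumes c: "geometric_growth c" and S: "open S" "z \<in> S"
    and u: "\<And>t. t \<in> S \<Longrightarrow> (u has_field_derivative u' t) (at t)"
    and v: "\<And>t. t \<in> S \<Longrightarrow> (v has_field_derivative v' t) (at t)"
  shows "has_mderiv (\<lambda>t. dexp_series c (u t) (v t))
    (u' z *\<^sub>M dexp_series (\<lambda>m n. c (Suc m) n) (u z) (v z)
      + v' z *\<^sub>M dexp_series (\<lambda>m n. c m (Suc n)) (u z) (v z)) z"
  unfolding has_mderiv_def
proof (intro allI)
  fix i j
  obtain r where r: "r > 0" "cball z r \<subseteq> S"
    using S open_contains_cball by blast
  obtain D K where DK: "D \<ge> 0" "K \<ge> 1" and cDK: "\<And>m n. norm (c m n) \<le> D * K ^ (m + n)"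
    using geometric_growthE[OF c] by blast
  have cont: "continuous_on (cball z r) u" "continuous_on (cball z r) v"
    using r(2) DERIV_continuous_on u v has_field_derivative_at_within by (metis subsetD)+
  have "bounded (u ` cball z r \<union> v ` cball z r)"
    using cont by (auto intro!: compact_imp_bounded compact_continuous_image)
  then obtain R where R: "\<And>t. t \<in> cball z r \<Longrightarrow> norm (u t) \<le> R \<and> norm (v t) \<le> R"
    unfolding bounded_iff by blast
  have "R \<ge> 0"
    using R[of z] r norm_ge_zero[of "u z"] by (simp del: norm_ge_zero)
  define f where "f p t = (case p of (m, n) \<Rightarrow>
    u t ^ m * v t ^ n / (fact m * fact n) * c m n $ i $ j)" for p t
  define f1 where "f1 p = (case p of (m, n) \<Rightarrow>
    of_nat m * u z ^ (m - 1) * v z ^ n / (fact m * fact n) * c m n $ i $ j)" for p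
  define f2 where "f2 p = (case p of (m, n) \<Rightarrow>
    of_nat n * u z ^ m * v z ^ (n - 1) / (fact m * fact n) * c m n $ i $ j)" for p
  define f' where "f' p t = (case p of (m, n) \<Rightarrow>
    (u' t * (of_nat m * u t ^ (m - 1) * v t ^ n) + v' t * (of_nat n * u t ^ m * v t ^ (n - 1)))
      / (fact m * fact n) * c m n $ i $ j)" for p t
  have f_deriv: "(f p has_field_derivative f' p t) (at t)" if "t \<in> S" for p t
    unfolding f_def f'_def using u[OF that] v[OF that]
    by (cases p) (auto intro!: derivative_eq_intros simp: field_simps)
  have f_cont: "continuous_on (cball z r) (f p)" for p
    using r(2) f_deriv DERIV_continuous_on has_field_derivative_at_within by (metis subsetD)
  have unif: "uniform_limit (cball z r) (\<lambda>X t. \<Sum>p\<in>X. f p t) (\<lambda>t. dexp_series c (u t) (v t) $ i $ j)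
      (finite_subsets_at_top UNIV)"
  proof (rule Weierstrass_m_test_general')
    show "norm (f p t) \<le> (case p of (m, n) \<Rightarrow> D * ((K * R) ^ m / fact m * ((K * R) ^ n / fact n)))"
      if "t \<in> cball z r" for p t
    proof (cases p)
      case (Pair m n)
      have "norm (c m n $ i $ j) \<le> D * K ^ (m + n)"
        by (rule order_trans[OF norm_nth_nth_le cDK])
      then show ?thesis
        using R[OF that] unfolding Pair f_def prod.case
        by (subst norm_mult, intro dexp_term_bound) auto
    qed
    show "((\<lambda>p. f p t) has_sum dexp_series c (u t) (v t) $ i $ j) UNIV" for t
      using has_sum_dexp_series_nth[OF c, of "u t" "v t" i j] by (simp add: f_def case_prod_unfold)
    show "(\<lambda>(m, n). D * ((K * R) ^ m / fact m * ((K * R) ^ n / fact n))) summable_on UNIV"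
      using DK \<open>R \<ge> 0\<close> by (intro dexp_majorant_summable) auto
  qed
  obtain g' where g': "\<And>w. w \<in> ball z r \<Longrightarrow>
      ((\<lambda>t. dexp_series c (u t) (v t) $ i $ j) has_field_derivative g' w) (at w) \<and>
      ((\<lambda>X. \<Sum>p\<in>X. f' p w) \<longlongrightarrow> g' w) (finite_subsets_at_top UNIV)"
  proof (rule has_complex_derivative_uniform_limit[OF _ unif _ r(1)])
    show "\<forall>\<^sub>F X in finite_subsets_at_top UNIV. continuous_on (cball z r) (\<lambda>t. \<Sum>p\<in>X. f p t) \<and>
        (\<forall>w\<in>ball z r. ((\<lambda>t. \<Sum>p\<in>X. f p t) has_field_derivative (\<Sum>p\<in>X. f' p w)) (at w))"
      using r(2) by (intro always_eventually allI conjI ballI continuous_on_sum f_cont DERIV_sum f_deriv) auto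
  qed (auto intro: that)
  then have deriv: "((\<lambda>t. dexp_series c (u t) (v t) $ i $ j) has_field_derivative g' z) (at z)"
    and sum: "((\<lambda>p. f' p z) has_sum g' z) UNIV"
    using r(1) by (auto simp: has_sum_def)
  have "(f1 has_sum dexp_series (\<lambda>m n. c (Suc m) n) (u z) (v z) $ i $ j) UNIV"
    unfolding f1_def
  proof (rule has_sum_shift_fst)
    have "of_nat (Suc m) * u z ^ (Suc m - 1) * v z ^ n / (fact (Suc m) * fact n)
        = u z ^ m * v z ^ n / (fact m * fact n)" for m n
      using of_nat_Suc_over_fact[of m] by (simp add: divide_simps del: of_nat_Suc)
    then show "((\<lambda>(m, n). of_nat (Suc m) * u z ^ (Suc m - 1) * v z ^ n / (fact (Suc m) * fact n)
        * c (Suc m) n $ i $ j) has_sum dexp_series (\<lambda>m n. c (Suc m) n) (u z) (v z) $ i $ j) UNIV"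
      using has_sum_dexp_series_nth[OF geometric_growth_shift_fst[OF c]] by simp
  qed simp
  moreover have "(f2 has_sum dexp_series (\<lambda>m n. c m (Suc n)) (u z) (v z) $ i $ j) UNIV"
    unfolding f2_def
  proof (rule has_sum_shift_snd)
    have "of_nat (Suc n) * u z ^ m * v z ^ (Suc n - 1) / (fact m * fact (Suc n))
        = u z ^ m * v z ^ n / (fact m * fact n)" for m n
      using of_nat_Suc_over_fact[of n] by (simp add: divide_simps del: of_nat_Suc)
    then show "((\<lambda>(m, n). of_nat (Suc n) * u z ^ m * v z ^ (Suc n - 1) / (fact m * fact (Suc n))
        * c m (Suc n) $ i $ j) has_sum dexp_series (\<lambda>m n. c m (Suc n)) (u z) (v z) $ i $ j) UNIV"
      using has_sum_dexp_series_nth[OF geometric_growth_shift_snd[OF c]] by simp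
  qed simp
  ultimately have "((\<lambda>p. u' z * f1 p + v' z * f2 p) has_sum
      u' z * dexp_series (\<lambda>m n. c (Suc m) n) (u z) (v z) $ i $ j
      + v' z * dexp_series (\<lambda>m n. c m (Suc n)) (u z) (v z) $ i $ j) UNIV"
    by (intro has_sum_add has_sum_cmult_right)
  moreover have "u' z * f1 p + v' z * f2 p = f' p z" for p
    by (cases p) (simp add: f1_def f2_def f'_def field_simps)
  ultimately have "g' z = u' z * dexp_series (\<lambda>m n. c (Suc m) n) (u z) (v z) $ i $ j
      + v' z * dexp_series (\<lambda>m n. c m (Suc n)) (u z) (v z) $ i $ j"
    using has_sum_unique[OF sum] by simp
  then show "((\<lambda>t. dexp_series c (u t) (v t) $ i $ j) has_field_derivative
      (u' z *\<^sub>M dexp_series (\<lambda>m n. c (Suc m) n) (u z) (v z)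
        + v' z *\<^sub>M dexp_series (\<lambda>m n. c m (Suc n)) (u z) (v z)) $ i $ j) (at z)"
    using deriv by simp
qed

section \<open>Matrix exponentials and matrix powers of a complex variable\<close>

lemma commuting_matrix_power: "commuting X M \<Longrightarrow> commuting X (matrix_power M n)"
  by (induction n) (auto intro!: commuting_mult)

lemma matrix_power_Suc_left: "matrix_power M (Suc n) = M ** matrix_power M n"
  using commuting_matrix_power[of M M n] by (simp add: commuting_def)

lemma matrix_power_cscale: "matrix_power (t *\<^sub>M M) n = t ^ n *\<^sub>M matrix_power M n"
  by (induction n) (simp_all add: cscale_mult_left cscale_mult_right mult.commute)

lemma geometric_growth_matrix_power: "geometric_growth (\<lambda>m n. matrix_power M m)"
  for M :: "complex^'d^'d"
proof (rule geometric_growthI)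
  show "norm (matrix_power M m) \<le> norm (mat 1 :: complex^'d^'d) * (1 + norm M) ^ (m + n)" for m n
  proof -
    have "norm (matrix_power M m) \<le> norm (mat 1 :: complex^'d^'d) * (1 + norm M) ^ m"
    proof (induction m)
      case (Suc m)
      have "norm (matrix_power M (Suc m)) \<le> norm (matrix_power M m) * norm M"
        by (simp add: norm_matrix_mult_le)
      also have "\<dots> \<le> (norm (mat 1 :: complex^'d^'d) * (1 + norm M) ^ m) * (1 + norm M)"
        by (intro mult_mono Suc) auto
      finally show ?case
        by (simp add: mult_ac)
    qed simp
    also have "\<dots> \<le> norm (mat 1 :: complex^'d^'d) * (1 + norm M) ^ (m + n)"
      by (intro mult_left_mono power_increasing) auto
    finally show ?thesis .
  qed
qed auto

text \<open>With second argument 0 only the terms \<open>n = 0\<close> survive, so that the matrix exponential is a double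
  exponential series and inherits its differentiation rule and its linearity.\<close>

lemma matrix_exp_eq_dexp_series:
  "matrix_exp (t *\<^sub>M M) = dexp_series (\<lambda>m n. matrix_power M m) t 0"
proof -
  let ?S = "dexp_series (\<lambda>m n. matrix_power M m) t 0"
  let ?f = "\<lambda>(m, n). (t ^ m * 0 ^ n / (fact m * fact n)) *\<^sub>M matrix_power M m"
  have "(?f has_sum ?S) UNIV"
    by (rule has_sum_dexp_series[OF geometric_growth_matrix_power])
  also have "(?f has_sum ?S) UNIV \<longleftrightarrow> (?f has_sum ?S) (range (\<lambda>m. (m, 0)))"
    by (rule has_sum_cong_neutral) (auto simp: image_iff zero_power)
  also have "\<dots> \<longleftrightarrow> ((\<lambda>m. (1 / fact m) *\<^sub>M matrix_power (t *\<^sub>M M) m) has_sum ?S) UNIV"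
    by (subst has_sum_reindex) (auto simp: inj_on_def o_def matrix_power_cscale)
  finally show ?thesis
    unfolding matrix_exp_def by (intro sums_unique[symmetric] has_sum_imp_sums)
qed

lemma matrix_exp_0: "matrix_exp 0 = (mat 1 :: complex^'d^'d)"
proof -
  have "(1 / fact n) *\<^sub>M matrix_power 0 n = (0 :: complex^'d^'d)" if "n \<noteq> 0" for n
    using that by (cases n) simp_all
  then show ?thesis
    unfolding matrix_exp_def by (subst suminf_finite[of "{0}"]) auto
qed

lemma commuting_matrix_exp:
  assumes "commuting X M"
  shows "commuting X (matrix_exp (t *\<^sub>M M))"
proof -
  have "X ** matrix_power M m = matrix_power M m ** X" for m
    using commuting_matrix_power[OF assms] by (simp add: commuting_def)
  then show ?thesis
    unfolding commuting_def matrix_exp_eq_dexp_series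
    by (simp flip: dexp_series_mult_left[OF geometric_growth_matrix_power]
        dexp_series_mult_right[OF geometric_growth_matrix_power])
qed

lemma has_mderiv_matrix_exp:
  assumes "open S" "z \<in> S" "\<And>t. t \<in> S \<Longrightarrow> (u has_field_derivative u' t) (at t)"
  shows "has_mderiv (\<lambda>t. matrix_exp (u t *\<^sub>M M)) (u' z *\<^sub>M (M ** matrix_exp (u z *\<^sub>M M))) z"
  using has_mderiv_dexp_series_curve[OF geometric_growth_matrix_power assms, of "\<lambda>_. 0" "\<lambda>_. 0" M]
  unfolding matrix_exp_eq_dexp_series matrix_power_Suc_left
  by (simp add: dexp_series_mult_left[OF geometric_growth_matrix_power])

text \<open>The function \<open>exp(-ct) exp(-tM) exp(t(M + cI))\<close> of \<open>t\<close> has derivative zero and equals \<open>I\<close> at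
  \<open>t = 0\<close>. With \<open>c = 0\<close> this says that \<open>exp(-tM)\<close> inverts \<open>exp(tM)\<close>, and it then yields
  \<open>exp(t(M + cI)) = exp(ct) exp(tM)\<close> without multiplying two series.\<close>

lemma matrix_exp_minus_mult:
  fixes M :: "complex^'d^'d"
  shows "exp (- c * t) *\<^sub>M (matrix_exp (t *\<^sub>M (- M)) ** matrix_exp (t *\<^sub>M (M + mat c))) = mat 1"
proof -
  define E where "E t = matrix_exp (t *\<^sub>M (- M))" for t
  define F where "F t = matrix_exp (t *\<^sub>M (M + mat c))" for t
  define f where "f t = exp (- c * t) *\<^sub>M (E t ** F t)" for t
  have "has_mderiv f 0 t" for t
  proof -
    have E: "has_mderiv E (- (M ** E t)) t" and F: "has_mderiv F (M ** F t + c *\<^sub>M F t) t"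
      using has_mderiv_matrix_exp[of UNIV t "\<lambda>t. t" "\<lambda>_. 1" "- M"]
        has_mderiv_matrix_exp[of UNIV t "\<lambda>t. t" "\<lambda>_. 1" "M + mat c"]
      unfolding E_def[abs_def] F_def[abs_def]
      by (simp_all add: matrix_minus_left matrix_add_rdistrib mat_mult_left)
    have comm: "E t ** (M ** F t) = M ** E t ** F t"
      using commuting_matrix_exp[of M "- M" t] commuting_minus[of M M]
      by (simp add: E_def commuting_def matrix_mul_assoc)
    have "((\<lambda>t. exp (- c * t)) has_field_derivative - c * exp (- c * t)) (at t)"
      by (auto intro!: derivative_eq_intros)
    from has_mderiv_cscale[OF this has_mderiv_mult[OF E F]] show ?thesis
      by (simp add: f_def[abs_def] matrix_distribs comm cscale_minus_left mult.commute)
  qed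
  then have "((\<lambda>t. f t $ i $ j) has_field_derivative 0) (at t within UNIV)" for i j t
    by (simp add: has_mderiv_def)
  then have "f t $ i $ j = f 0 $ i $ j" for i j
    using has_field_derivative_zero_constant[OF convex_UNIV] by (metis UNIV_I)
  then have "f t = f 0"
    by (simp add: vec_eq_iff)
  then show ?thesis
    by (simp add: f_def E_def F_def matrix_exp_0)
qed

lemma matrix_exp_add_mat:
  fixes M :: "complex^'d^'d"
  shows "matrix_exp (t *\<^sub>M (M + mat c)) = exp (c * t) *\<^sub>M matrix_exp (t *\<^sub>M M)"
proof -
  let ?E = "matrix_exp (t *\<^sub>M M)" and ?E' = "matrix_exp (t *\<^sub>M (- M))"
  let ?F = "matrix_exp (t *\<^sub>M (M + mat c))"
  have inv: "?E ** ?E' = mat 1"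
    using matrix_exp_minus_mult[of 0 t "- M"] by simp
  have F: "exp (- c * t) *\<^sub>M (?E' ** ?F) = mat 1"
    by (rule matrix_exp_minus_mult)
  have "exp (c * t) *\<^sub>M ?E = exp (c * t) *\<^sub>M (?E ** (exp (- c * t) *\<^sub>M (?E' ** ?F)))"
    by (simp only: F matrix_mul_rid)
  also have "\<dots> = ?E ** ?E' ** ?F"
    by (simp add: cscale_mult_right matrix_mul_assoc flip: exp_add)
  finally show ?thesis
    by (simp add: inv)
qed

text \<open>The principal logarithm does no harm here, since \<open>exp(Ln x) = x\<close> for every \<open>x \<noteq> 0\<close>.\<close>

lemma cpow_matrix_add_one:
  assumes "x \<noteq> 0"
  shows "cpow_matrix x (M + mat 1) = x *\<^sub>M cpow_matrix x M"
  using assms by (simp add: cpow_matrix_def matrix_exp_add_mat)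

lemma commuting_cpow_matrix: "commuting X M \<Longrightarrow> commuting X (cpow_matrix x M)"
  unfolding cpow_matrix_def by (rule commuting_matrix_exp)

lemma has_mderiv_cpow_matrix:
  assumes "x \<notin> \<real>\<^sub>\<le>\<^sub>0"
  shows "has_mderiv (\<lambda>t. cpow_matrix t M) (inverse x *\<^sub>M (M ** cpow_matrix x M)) x"
  unfolding cpow_matrix_def
  by (rule has_mderiv_matrix_exp[of "- \<real>\<^sub>\<le>\<^sub>0"])
    (use assms closed_nonpos_Reals_complex in \<open>auto intro!: has_field_derivative_Ln\<close>)

section \<open>The series of the Horn function\<close>

definition h4_coeff ::
  "complex^'d^'d \<Rightarrow> complex^'d^'d \<Rightarrow> complex^'d^'d \<Rightarrow> nat \<Rightarrow> nat \<Rightarrow> complex^'d^'d" where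
  "h4_coeff A B C m n = mpoch_int A (int m - int n) ** mpoch B n ** matrix_inv (mpoch C m)"

lemma horn_H4_eq_dexp_series: "horn_H4 A B C x y = dexp_series (h4_coeff A B C) x y"
  by (simp add: horn_H4_def dexp_series_def h4_coeff_def)

text \<open>\<open>C\<close> has no eigenvalue in \<open>{0, -1, -2, \<dots>}\<close>: all \<open>(C)\<^sub>m\<close> are invertible.\<close>

definition nonneg_regular :: "complex^'d^'d \<Rightarrow> bool" where
  "nonneg_regular C \<longleftrightarrow> (\<forall>k::nat. invertible (C + mat (of_nat k)))"

text \<open>\<open>A\<close> has no positive integer as eigenvalue: all \<open>(A)\<^sub>-\<^sub>n\<close> are meaningful.\<close>

definition neg_regular :: "complex^'d^'d \<Rightarrow> bool" where
  "neg_regular A \<longleftrightarrow> (\<forall>k::nat. k \<ge> 1 \<longrightarrow> invertible (A - mat (of_nat k)))"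

lemma neg_regularD: "neg_regular A \<Longrightarrow> k \<ge> 1 \<Longrightarrow> invertible (A - mat (of_nat k))"
  by (simp add: neg_regular_def)

lemma nonneg_regular_one_minus: "neg_regular A \<Longrightarrow> nonneg_regular (mat 1 - A)"
  unfolding neg_regular_def nonneg_regular_def using invertible_neg_shift[of A] by blast

lemma nonneg_regular_add:
  assumes "nonneg_regular C"
  shows "nonneg_regular (C + mat (of_nat r))"
  using assms unfolding nonneg_regular_def by (metis add.assoc mat_add of_nat_add)

lemma neg_regular_diff:
  assumes "neg_regular A"
  shows "neg_regular (A - mat (of_nat r))"
  unfolding neg_regular_def
proof (intro allI impI)
  fix k :: nat
  assume "k \<ge> 1"
  then have "invertible (A - mat (of_nat (r + k)))"
    by (intro neg_regularD[OF assms]) simp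
  moreover have "A - mat (of_nat r) - mat (of_nat k) = A - mat (of_nat (r + k))"
    by (simp add: mat_add algebra_simps)
  ultimately show "invertible (A - mat (of_nat r) - mat (of_nat k))"
    by (simp only:)
qed

text \<open>Adding \<open>rI\<close> to a matrix none of whose eigenvalues is a positive integer moves exactly the
  eigenvalues \<open>0, -1, \<dots>, 1 - r\<close> to positive integers.\<close>

lemma neg_regular_add:
  assumes "neg_regular A" "\<And>j. j < r \<Longrightarrow> invertible (A + mat (of_nat j))"
  shows "neg_regular (A + mat (of_nat r))"
  unfolding neg_regular_def
proof (intro allI impI)
  fix k :: nat
  assume "k \<ge> 1"
  show "invertible (A + mat (of_nat r) - mat (of_nat k))"
  proof (cases "k \<le> r")
    case True
    then show ?thesis
      using assms(2)[of "r - k"] \<open>k \<ge> 1\<close> by (simp add: of_nat_diff mat_diff algebra_simps)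
  next
    case False
    then have "invertible (A - mat (of_nat (k - r)))"
      by (intro neg_regularD[OF assms(1)]) simp
    moreover have "A + mat (of_nat r) - mat (of_nat k) = A - mat (of_nat (k - r))"
      using False by (simp add: of_nat_diff mat_diff algebra_simps)
    ultimately show ?thesis
      by (simp only:)
  qed
qed

lemma neg_regular_add_one:
  assumes "neg_regular A" "invertible A"
  shows "neg_regular (A + mat 1)"
  using neg_regular_add[of A 1] assms by simp

lemma fact_ratio_le:
  "(if n \<le> m then fact (m - n) else 1 / fact (n - m)) * fact n / fact m \<le> (2 ^ (m + n) :: real)"
proof (cases "n \<le> m")
  case True
  have "real (m choose n) \<ge> 1"
    using True by (simp add: Suc_leI)
  then have "fact (m - n) * fact n \<le> (fact m :: real)"
    using True by (simp add: binomial_fact field_simps)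
  then have "fact (m - n) * fact n / fact m \<le> (1 :: real)"
    by simp
  also have "(1 :: real) \<le> 2 ^ (m + n)"
    by simp
  finally show ?thesis
    using True by simp
next
  case False
  have "real (n choose m) \<le> 2 ^ n"
    using binomial_le_pow2[of n m] by (metis of_nat_le_iff of_nat_numeral of_nat_power)
  also have "(2 :: real) ^ n \<le> 2 ^ (m + n)"
    by simp
  finally show ?thesis
    using False by (simp add: binomial_fact field_simps)
qed

text \<open>Up to geometric factors \<open>(A)\<^sub>m\<^sub>-\<^sub>n (B)\<^sub>n (C)\<^sub>m\<^sup>-\<^sup>1\<close> has size \<open>(m - n)! n! / m!\<close>, which is at
  most 1 for \<open>n \<le> m\<close>; with \<open>1 / (n - m)!\<close> for \<open>(m - n)!\<close> when \<open>n > m\<close> it is the binomial coefficient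
  \<open>n\<close> over \<open>m\<close>.\<close>

lemma geometric_growth_h4_coeff:
  assumes A: "neg_regular A" and C: "nonneg_regular C"
  shows "geometric_growth (h4_coeff A B C)"
proof -
  obtain K1 where K1: "K1 \<ge> 1" "\<And>n. norm (mpoch A n) \<le> K1 ^ Suc n * fact n"
    using mpoch_growth by metis
  obtain K2 where K2: "K2 \<ge> 1" "\<And>n. norm (matrix_inv (mpoch (mat 1 - A) n)) \<le> K2 ^ Suc n / fact n"
    using mpoch_inv_growth[of "mat 1 - A"] nonneg_regular_one_minus[OF A] unfolding nonneg_regular_def by metis
  obtain K3 where K3: "K3 \<ge> 1" "\<And>n. norm (mpoch B n) \<le> K3 ^ Suc n * fact n"
    using mpoch_growth by metis
  obtain K4 where K4: "K4 \<ge> 1" "\<And>n. norm (matrix_inv (mpoch C n)) \<le> K4 ^ Suc n / fact n"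
    using mpoch_inv_growth[of C] C unfolding nonneg_regular_def by metis
  define q where "q m n = (if n \<le> m then fact (m - n) else 1 / fact (n - m) :: real)" for m n
  define K where "K = K1 * K2"
  have K: "K1 \<le> K" "K2 \<le> K" "1 \<le> K"
    using K1(1) K2(1) mult_mono[of 1 K1 1 K2] by (simp_all add: K_def)
  have mono: "L ^ Suc k \<le> K ^ Suc (m + n)" if "L \<le> K" "0 \<le> L" "k \<le> m + n" for L k m n
    using that K order_trans[OF power_mono[OF that(1,2)] power_increasing[of "Suc k" "Suc (m + n)" K]]
    by simp
  have nA: "norm (mpoch_int A (int m - int n)) \<le> K ^ Suc (m + n) * q m n" for m n
  proof (cases "n \<le> m")
    case True
    then have "mpoch_int A (int m - int n) = mpoch A (m - n)"
      by (simp add: mpoch_int_def nat_diff_distrib)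
    also have "norm \<dots> \<le> K ^ Suc (m + n) * fact (m - n)"
      by (rule order_trans[OF K1(2) mult_right_mono[OF mono]]) (use K K1(1) in auto)
    finally show ?thesis
      using True by (simp add: q_def)
  next
    case False
    then have "mpoch_int A (int m - int n) = (-1) ^ (n - m) *\<^sub>M matrix_inv (mpoch (mat 1 - A) (n - m))"
      using mpoch_int_neg[of "n - m" A] by (simp add: of_nat_diff)
    also have "norm \<dots> \<le> K ^ Suc (m + n) / fact (n - m)"
      unfolding norm_cscale norm_power
      using order_trans[OF K2(2) divide_right_mono[OF mono]] K K2(1) by simp
    finally show ?thesis
      using False by (simp add: q_def)
  qed
  show ?thesis
  proof (rule geometric_growthI)
    show "0 \<le> K * K3 * K4" "1 \<le> 2 * (K * K3 * K4)"
      using K K3(1) K4(1) mult_mono[of 1 "K * K3" 1 K4] mult_mono[of 1 K 1 K3] by simp_all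
    fix m n
    have "norm (h4_coeff A B C m n)
        \<le> norm (mpoch_int A (int m - int n)) * norm (mpoch B n) * norm (matrix_inv (mpoch C m))"
      unfolding h4_coeff_def
      by (intro order_trans[OF norm_matrix_mult_le] mult_right_mono norm_matrix_mult_le) simp
    also have "\<dots> \<le> (K ^ Suc (m + n) * q m n) * (K3 ^ Suc n * fact n) * (K4 ^ Suc m / fact m)"
      using K K3(1) K4(1) by (intro mult_mono nA K3 K4 mult_nonneg_nonneg) (auto simp: q_def)
    also have "\<dots> = (K ^ Suc (m + n) * K3 ^ Suc n * K4 ^ Suc m) * (q m n * fact n / fact m)"
      by simp
    also have "\<dots> \<le> (K ^ Suc (m + n) * K3 ^ Suc (m + n) * K4 ^ Suc (m + n)) * 2 ^ (m + n)"
      using K K3(1) K4(1) fact_ratio_le[of n m]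
      by (intro mult_mono power_increasing mult_nonneg_nonneg) (auto simp: q_def)
    also have "\<dots> = K * K3 * K4 * (2 * (K * K3 * K4)) ^ (m + n)"
      by (simp add: power_mult_distrib mult_ac)
    finally show "norm (h4_coeff A B C m n) \<le> K * K3 * K4 * (2 * (K * K3 * K4)) ^ (m + n)" .
  qed
qed

section \<open>Contiguity relations of the coefficients\<close>

lemma nonneg_regular_invertible: "nonneg_regular C \<Longrightarrow> invertible C"
  unfolding nonneg_regular_def by (metis mat_0 add.right_neutral of_nat_0)

lemma nonneg_regular_add_one: "nonneg_regular C \<Longrightarrow> nonneg_regular (C + mat 1)"
  using nonneg_regular_add[of C 1] by simp

lemma nonneg_regular_mpoch: "nonneg_regular C \<Longrightarrow> invertible (mpoch C n)"
  unfolding nonneg_regular_def by (intro invertible_mpoch) auto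

text \<open>Differentiating in \<open>x\<close> or \<open>y\<close> shifts an index, and each Pochhammer symbol with a shifted
  index absorbs the change into its parameter at the cost of a factor at its front, which is
  inverted where an index of \<open>A\<close> is lowered. That factor can leave the product on the left if it
  belongs to \<open>A\<close> and on the right if it belongs to \<open>C\<close>. The symbol of \<open>B\<close> stands in the middle, and
  its factor \<open>B\<close> has to pass \<open>(C)\<^sub>m\<^sup>-\<^sup>1\<close>: hence the hypothesis that \<open>B\<close> and \<open>C\<close> commute in the
  formulae that change \<open>B\<close>.\<close>

lemma h4_coeff_Suc_fst:
  assumes "neg_regular A" "invertible A" "nonneg_regular C"
  shows "h4_coeff A B C (Suc m) n = A ** h4_coeff (A + mat 1) B (C + mat 1) m n ** matrix_inv C"
proof -
  have "mpoch_int A (int (Suc m) - int n) = A ** mpoch_int (A + mat 1) (int m - int n)"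
    using mpoch_int_shift[of A "int m - int n"] neg_regularD[OF assms(1)] assms(2)
    by (simp add: algebra_simps)
  moreover have "matrix_inv (mpoch C (Suc m)) = matrix_inv (mpoch (C + mat 1) m) ** matrix_inv C"
    unfolding mpoch_Suc_left using assms(3)
    by (intro matrix_inv_mult nonneg_regular_mpoch nonneg_regular_add_one nonneg_regular_invertible)
  ultimately show ?thesis
    by (simp add: h4_coeff_def matrix_mul_assoc)
qed

lemma h4_coeff_Suc_snd:
  assumes A: "neg_regular A" and C: "nonneg_regular C" and BC: "commuting B C"
  shows "h4_coeff A B C m (Suc n)
    = - (matrix_inv (mat 1 - A) ** h4_coeff (A - mat 1) (B + mat 1) C m n ** B)"
proof -
  let ?k = "int m - int n"
  have inv: "invertible (A - mat 1)"
    using neg_regularD[OF A, of 1] by simp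
  have "neg_regular (A - mat 1)"
    using neg_regular_diff[OF A, of 1] by simp
  then have "mpoch_int (A - mat 1) ?k = (A - mat 1) ** mpoch_int A (?k - 1)"
    using mpoch_int_shift[of "A - mat 1" "?k - 1", OF neg_regularD inv] by simp
  then have "mpoch_int A (?k - 1) = matrix_inv (A - mat 1) ** mpoch_int (A - mat 1) ?k"
    by (simp add: matrix_mul_assoc matrix_inv_left[OF inv])
  also have "matrix_inv (A - mat 1) = - matrix_inv (mat 1 - A)"
    using matrix_inv_minus[OF inv] by simp
  finally have a: "mpoch_int A (?k - 1) = - (matrix_inv (mat 1 - A) ** mpoch_int (A - mat 1) ?k)"
    by (simp add: matrix_minus_left)
  have "commuting B (mpoch (B + mat 1) n ** matrix_inv (mpoch C m))"
    using BC nonneg_regular_mpoch[OF C]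
    by (intro commuting_mult commuting_inv commuting_mpoch commuting_add) auto
  then have b: "mpoch B (Suc n) ** matrix_inv (mpoch C m)
      = mpoch (B + mat 1) n ** matrix_inv (mpoch C m) ** B"
    unfolding mpoch_Suc_left commuting_def by (simp add: matrix_mul_assoc)
  have "h4_coeff A B C m (Suc n) = mpoch_int A (?k - 1) ** (mpoch B (Suc n) ** matrix_inv (mpoch C m))"
    by (simp only: h4_coeff_def matrix_mul_assoc of_nat_Suc) (simp add: algebra_simps)
  then show ?thesis
    unfolding a b by (simp add: h4_coeff_def matrix_mul_assoc matrix_minus_left)
qed

text \<open>The next three relations serve the formulae with a power of the variable. An Euler operator
  applied to \<open>x\<^sup>M\<close> times a monomial multiplies the coefficient by \<open>M\<close> plus the exponent, which here
  is the last factor of a Pochhammer symbol: \<open>(A)\<^sub>k (A + kI) = (A)\<^sub>k\<^sub>+\<^sub>1 = A (A + I)\<^sub>k\<close> with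
  \<open>k = m - n\<close>, likewise for \<open>B\<close> with \<open>k = n\<close>.\<close>

lemma h4_coeff_raise_A:
  assumes "neg_regular A" "invertible A"
  shows "(A + mat (of_int (int m - int n))) ** h4_coeff A B C m n = A ** h4_coeff (A + mat 1) B C m n"
proof -
  let ?k = "int m - int n"
  have "commuting (A + mat (of_int ?k)) (mpoch_int A ?k)"
    by (rule commuting_sym, intro commuting_add commuting_sym[OF commuting_mpoch_int])
      (use neg_regularD[OF assms(1)] in auto)
  then have "(A + mat (of_int ?k)) ** mpoch_int A ?k = A ** mpoch_int (A + mat 1) ?k"
    using mpoch_int_add_one[of A ?k] mpoch_int_shift[of A ?k] neg_regularD[OF assms(1)] assms(2)
    by (simp add: commuting_def)
  then show ?thesis
    by (simp add: h4_coeff_def matrix_mul_assoc)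
qed

lemma h4_coeff_raise_B:
  assumes C: "nonneg_regular C" and BC: "commuting B C"
  shows "h4_coeff A B C m n ** (B + mat (of_nat n)) = h4_coeff A (B + mat 1) C m n ** B"
proof -
  let ?I = "matrix_inv (mpoch C m)"
  have BI: "commuting B ?I"
    using BC nonneg_regular_mpoch[OF C] by (intro commuting_inv commuting_mpoch)
  then have "commuting (B + mat (of_nat n)) ?I"
    by (intro commuting_sym[OF commuting_add[OF commuting_sym]]) auto
  then have "mpoch B n ** ?I ** (B + mat (of_nat n)) = mpoch B (Suc n) ** ?I"
    by (simp add: commuting_def flip: matrix_mul_assoc)
  also have "mpoch B (Suc n) = mpoch (B + mat 1) n ** B"
    unfolding mpoch_Suc_left
    using commuting_mpoch[of B "B + mat 1" n] commuting_add[of B B "mat 1"] by (simp add: commuting_def)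
  also have "mpoch (B + mat 1) n ** B ** ?I = mpoch (B + mat 1) n ** ?I ** B"
    using BI by (simp add: commuting_def flip: matrix_mul_assoc)
  finally show ?thesis
    by (simp add: h4_coeff_def flip: matrix_mul_assoc)
qed

text \<open>Here the inverted symbol loses a factor: \<open>(C - I) (C)\<^sub>m = (C - I)\<^sub>m (C + (m - 1)I)\<close>, both being
  \<open>(C - I)\<^sub>m\<^sub>+\<^sub>1\<close>. The power is \<open>x\<^bsup>C - I\<^esup>\<close> since its exponent must be this factor at \<open>m = 0\<close>.\<close>

lemma h4_coeff_lower_C:
  assumes C: "nonneg_regular C" and C1: "nonneg_regular (C - mat 1)"
  shows "h4_coeff A B C m n ** (C - mat 1 + mat (of_nat m))
    = h4_coeff A B (C - mat 1) m n ** (C - mat 1)"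
proof -
  let ?Y = "mpoch C m" and ?X = "mpoch (C - mat 1) m" and ?F = "C - mat 1 + mat (of_nat m)"
  have "commuting ?F C"
    by (intro commuting_sym[OF commuting_add[OF commuting_diff]]) auto
  then have "commuting ?F (matrix_inv ?Y)"
    by (intro commuting_inv commuting_mpoch nonneg_regular_mpoch C)
  then have "matrix_inv ?Y ** ?F = matrix_inv ?X ** (?X ** ?F) ** matrix_inv ?Y"
    by (simp add: commuting_def matrix_mul_assoc matrix_inv_left nonneg_regular_mpoch[OF C1])
  also have "?X ** ?F = (C - mat 1) ** ?Y"
    using mpoch_Suc_left[of "C - mat 1" m] by simp
  also have "matrix_inv ?X ** ((C - mat 1) ** ?Y) ** matrix_inv ?Y
      = matrix_inv ?X ** (C - mat 1) ** (?Y ** matrix_inv ?Y)"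
    by (simp add: matrix_mul_assoc)
  finally show ?thesis
    by (simp add: h4_coeff_def matrix_inv_right nonneg_regular_mpoch[OF C] flip: matrix_mul_assoc)
qed

section \<open>The five formulae for one derivative\<close>

lemma has_mderiv_horn_H4_fst:
  assumes "neg_regular A" "invertible A" "nonneg_regular C"
  shows "has_mderiv (\<lambda>x. horn_H4 A B C x y)
    (A ** horn_H4 (A + mat 1) B (C + mat 1) x y ** matrix_inv C) x"
proof -
  have growth: "geometric_growth (h4_coeff A B C)" "geometric_growth (h4_coeff (A + mat 1) B (C + mat 1))"
    using assms by (auto intro!: geometric_growth_h4_coeff neg_regular_add_one nonneg_regular_add_one)
  have "has_mderiv (\<lambda>x. horn_H4 A B C x y) (dexp_series (\<lambda>m n. h4_coeff A B C (Suc m) n) x y) x"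
    unfolding horn_H4_eq_dexp_series
    using has_mderiv_dexp_series_curve[OF growth(1), of UNIV x "\<lambda>x. x" "\<lambda>_. 1" "\<lambda>_. y" "\<lambda>_. 0"] by simp
  then show ?thesis
    by (simp add: h4_coeff_Suc_fst assms dexp_series_sandwich growth horn_H4_eq_dexp_series)
qed

lemma has_mderiv_horn_H4_snd:
  assumes "neg_regular A" "nonneg_regular C" "commuting B C"
  shows "has_mderiv (\<lambda>y. horn_H4 A B C x y)
    (- (matrix_inv (mat 1 - A) ** horn_H4 (A - mat 1) (B + mat 1) C x y ** B)) y"
proof -
  have growth: "geometric_growth (h4_coeff A B C)" "geometric_growth (h4_coeff (A - mat 1) (B + mat 1) C)"
    using assms neg_regular_diff[of A 1] by (auto intro!: geometric_growth_h4_coeff)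
  have "has_mderiv (\<lambda>y. horn_H4 A B C x y) (dexp_series (\<lambda>m n. h4_coeff A B C m (Suc n)) x y) y"
    unfolding horn_H4_eq_dexp_series
    using has_mderiv_dexp_series_curve[OF growth(1), of UNIV y "\<lambda>_. x" "\<lambda>_. 0" "\<lambda>y. y" "\<lambda>_. 1"] by simp
  then show ?thesis
    by (simp add: h4_coeff_Suc_snd assms dexp_series_sandwich geometric_growth_sandwich
        dexp_series_minus growth horn_H4_eq_dexp_series)
qed

text \<open>Along \<open>(x, y/x)\<close> the operator \<open>x d/dx\<close> is the difference of the two Euler operators and multiplies
  the coefficients by \<open>m - n\<close>; together with \<open>A\<close> from the power this is the factor \<open>A + (m - n)I\<close>.
  One more factor \<open>x\<close> raises the exponent of the power.\<close>

lemma has_mderiv_cpow_horn_H4_fst: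
  assumes A: "neg_regular A" "invertible A" and C: "nonneg_regular C" and x: "x \<notin> \<real>\<^sub>\<le>\<^sub>0"
  shows "has_mderiv (\<lambda>x. cpow_matrix x A ** horn_H4 A B C x (y / x))
    ((1 / x\<^sup>2) *\<^sub>M (cpow_matrix x (A + mat 1) ** A ** horn_H4 (A + mat 1) B C x (y / x))) x"
proof -
  let ?c = "h4_coeff A B C" and ?P = "cpow_matrix x A" and ?H = "horn_H4 A B C x (y / x)"
  let ?G1 = "dexp_series (\<lambda>m n. ?c (Suc m) n) x (y / x)"
  let ?G2 = "dexp_series (\<lambda>m n. ?c m (Suc n)) x (y / x)"
  have x0: "x \<noteq> 0"
    using x by auto
  have c: "geometric_growth ?c" and c': "geometric_growth (h4_coeff (A + mat 1) B C)"
    using A C by (auto intro!: geometric_growth_h4_coeff neg_regular_add_one)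
  have "has_mderiv (\<lambda>x. horn_H4 A B C x (y / x)) (1 *\<^sub>M ?G1 + (- y / x\<^sup>2) *\<^sub>M ?G2) x"
    unfolding horn_H4_eq_dexp_series
    by (rule has_mderiv_dexp_series_curve[OF c, of "- {0}" x "\<lambda>x. x" "\<lambda>_. 1" "\<lambda>x. y / x" "\<lambda>x. - y / x\<^sup>2"])
      (use x0 in \<open>auto intro!: derivative_eq_intros simp: power2_eq_square\<close>)
  from has_mderiv_mult[OF has_mderiv_cpow_matrix[OF x] this]
  have deriv: "has_mderiv (\<lambda>x. cpow_matrix x A ** horn_H4 A B C x (y / x))
    (inverse x *\<^sub>M (A ** ?P) ** ?H + ?P ** (1 *\<^sub>M ?G1 + (- y / x\<^sup>2) *\<^sub>M ?G2)) x" .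
  have euler: "dexp_series (\<lambda>m n. of_nat m *\<^sub>M ?c m n) x (y / x) = x *\<^sub>M ?G1"
      "dexp_series (\<lambda>m n. of_nat n *\<^sub>M ?c m n) x (y / x) = (y / x) *\<^sub>M ?G2"
    by (rule dexp_series_euler_fst dexp_series_euler_snd, rule c)+
  \<comment> \<open>The term with \<open>n\<close> is moved to the other side, which keeps all series sums of two series.\<close>
  have "A ** h4_coeff (A + mat 1) B C m n + of_nat n *\<^sub>M ?c m n = A ** ?c m n + of_nat m *\<^sub>M ?c m n" for m n
    unfolding h4_coeff_raise_A[OF A, symmetric]
    by (simp add: matrix_add_rdistrib mat_mult_left cscale_diff_left)
  then have "A ** horn_H4 (A + mat 1) B C x (y / x) + (y / x) *\<^sub>M ?G2 = A ** ?H + x *\<^sub>M ?G1"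
    using dexp_series_add[OF geometric_growth_mult_left[OF c'] geometric_growth_euler(2)[OF c],
        of A x "y / x"]
      dexp_series_add[OF geometric_growth_mult_left[OF c] geometric_growth_euler(1)[OF c],
        of A x "y / x"]
    by (simp add: horn_H4_eq_dexp_series euler dexp_series_mult_left c c')
  then have key: "A ** horn_H4 (A + mat 1) B C x (y / x) = A ** ?H + x *\<^sub>M ?G1 - (y / x) *\<^sub>M ?G2"
    by (simp add: eq_diff_eq)
  have comm: "A ** ?P = ?P ** A"
    using commuting_cpow_matrix[of A A x] by (simp add: commuting_def)
  have "(1 / x\<^sup>2) *\<^sub>M (cpow_matrix x (A + mat 1) ** A ** horn_H4 (A + mat 1) B C x (y / x))
      = inverse x *\<^sub>M (?P ** (A ** ?H + x *\<^sub>M ?G1 - (y / x) *\<^sub>M ?G2))"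
    using x0 unfolding matrix_mul_assoc[symmetric] key cpow_matrix_add_one[OF x0]
    by (simp add: cscale_mult_left power2_eq_square inverse_eq_divide)
  also have "\<dots> = inverse x *\<^sub>M (A ** ?P) ** ?H + ?P ** (1 *\<^sub>M ?G1 + (- y / x\<^sup>2) *\<^sub>M ?G2)"
    unfolding comm using x0
    by (simp add: matrix_add_ldistrib matrix_diff_ldistrib cscale_mult_left cscale_mult_right
        cscale_add_right cscale_diff_right cscale_minus_left matrix_minus_right matrix_mul_assoc
        power2_eq_square divide_inverse mult_ac)
  finally show ?thesis
    using deriv by simp
qed

lemma has_mderiv_horn_H4_cpow_snd:
  assumes A: "neg_regular A" and C: "nonneg_regular C" and BC: "commuting B C" and y: "y \<notin> \<real>\<^sub>\<le>\<^sub>0"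
  shows "has_mderiv (\<lambda>y. horn_H4 A B C x y ** cpow_matrix y B)
    ((1 / y\<^sup>2) *\<^sub>M (horn_H4 A (B + mat 1) C x y ** cpow_matrix y (B + mat 1) ** B)) y"
proof -
  let ?c = "h4_coeff A B C" and ?P = "cpow_matrix y B" and ?H = "horn_H4 A B C x y"
  let ?G = "dexp_series (\<lambda>m n. ?c m (Suc n)) x y"
  have y0: "y \<noteq> 0"
    using y by auto
  have c: "geometric_growth ?c" and c': "geometric_growth (h4_coeff A (B + mat 1) C)"
    using A C by (auto intro!: geometric_growth_h4_coeff)
  have "has_mderiv (\<lambda>y. horn_H4 A B C x y) ?G y"
    unfolding horn_H4_eq_dexp_series
    using has_mderiv_dexp_series_curve[OF c, of UNIV y "\<lambda>_. x" "\<lambda>_. 0" "\<lambda>y. y" "\<lambda>_. 1"] by simp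
  from has_mderiv_mult[OF this has_mderiv_cpow_matrix[OF y]]
  have deriv: "has_mderiv (\<lambda>y. horn_H4 A B C x y ** cpow_matrix y B)
    (?G ** ?P + ?H ** (inverse y *\<^sub>M (B ** ?P))) y" .
  have "h4_coeff A (B + mat 1) C m n ** B = ?c m n ** B + of_nat n *\<^sub>M ?c m n" for m n
    unfolding h4_coeff_raise_B[OF C BC, symmetric]
    by (simp add: matrix_add_ldistrib mat_mult_right)
  then have key: "horn_H4 A (B + mat 1) C x y ** B = ?H ** B + y *\<^sub>M ?G"
    using dexp_series_add[OF geometric_growth_mult_right[OF c] geometric_growth_euler(2)[OF c]]
    by (simp add: horn_H4_eq_dexp_series dexp_series_euler_snd c c' flip: dexp_series_mult_right)
  have comm: "B ** ?P = ?P ** B"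
    using commuting_cpow_matrix[of B B y] by (simp add: commuting_def)
  have "horn_H4 A (B + mat 1) C x y ** cpow_matrix y (B + mat 1) ** B
      = y *\<^sub>M ((horn_H4 A (B + mat 1) C x y ** B) ** ?P)"
    unfolding cpow_matrix_add_one[OF y0]
    by (simp add: cscale_mult_left cscale_mult_right comm flip: matrix_mul_assoc)
  then have "(1 / y\<^sup>2) *\<^sub>M (horn_H4 A (B + mat 1) C x y ** cpow_matrix y (B + mat 1) ** B)
      = inverse y *\<^sub>M ((?H ** B + y *\<^sub>M ?G) ** ?P)"
    using y0 unfolding key by (simp add: power2_eq_square inverse_eq_divide)
  also have "\<dots> = ?G ** ?P + ?H ** (inverse y *\<^sub>M (B ** ?P))"
    using y0 by (simp add: matrix_add_rdistrib cscale_mult_left cscale_mult_right cscale_add_right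
        matrix_mul_assoc)
  finally show ?thesis
    using deriv by simp
qed

lemma has_mderiv_horn_H4_cpow_fst:
  assumes A: "neg_regular A" and C: "nonneg_regular C" "nonneg_regular (C - mat 1)" and x: "x \<notin> \<real>\<^sub>\<le>\<^sub>0"
  shows "has_mderiv (\<lambda>x. horn_H4 A B C x y ** cpow_matrix x (C - mat 1))
    (horn_H4 A B (C - mat 1) x y ** cpow_matrix x (C - mat 2) ** (C - mat 1)) x"
proof -
  let ?c = "h4_coeff A B C" and ?P = "cpow_matrix x (C - mat 1)" and ?H = "horn_H4 A B C x y"
  let ?Q = "cpow_matrix x (C - mat 2)" and ?G = "dexp_series (\<lambda>m n. ?c (Suc m) n) x y"
  have x0: "x \<noteq> 0"
    using x by auto
  have c: "geometric_growth ?c" and c': "geometric_growth (h4_coeff A B (C - mat 1))"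
    using A C by (auto intro!: geometric_growth_h4_coeff)
  have "has_mderiv (\<lambda>x. horn_H4 A B C x y) ?G x"
    unfolding horn_H4_eq_dexp_series
    using has_mderiv_dexp_series_curve[OF c, of UNIV x "\<lambda>x. x" "\<lambda>_. 1" "\<lambda>_. y" "\<lambda>_. 0"] by simp
  from has_mderiv_mult[OF this has_mderiv_cpow_matrix[OF x]]
  have deriv: "has_mderiv (\<lambda>x. horn_H4 A B C x y ** cpow_matrix x (C - mat 1))
    (?G ** ?P + ?H ** (inverse x *\<^sub>M ((C - mat 1) ** ?P))) x" .
  have "h4_coeff A B (C - mat 1) m n ** (C - mat 1) = ?c m n ** (C - mat 1) + of_nat m *\<^sub>M ?c m n" for m n
    unfolding h4_coeff_lower_C[OF C, symmetric]
    by (simp add: matrix_add_ldistrib mat_mult_right)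
  then have key: "horn_H4 A B (C - mat 1) x y ** (C - mat 1) = ?H ** (C - mat 1) + x *\<^sub>M ?G"
    using dexp_series_add[OF geometric_growth_mult_right[OF c] geometric_growth_euler(1)[OF c]]
    by (simp add: horn_H4_eq_dexp_series dexp_series_euler_fst c c' flip: dexp_series_mult_right)
  have shift: "C - mat 2 + mat 1 = C - mat 1"
    by (simp add: vec_eq_iff mat_def)
  have P: "?P = x *\<^sub>M ?Q"
    using cpow_matrix_add_one[OF x0, of "C - mat 2"] unfolding shift .
  have "commuting (C - mat 1) (C - mat 2)"
    by (intro commuting_diff commuting_sym[OF commuting_diff]) auto
  then have "(C - mat 1) ** ?Q = ?Q ** (C - mat 1)"
    using commuting_cpow_matrix by (simp add: commuting_def)
  then have "horn_H4 A B (C - mat 1) x y ** ?Q ** (C - mat 1) = (?H ** (C - mat 1) + x *\<^sub>M ?G) ** ?Q"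
    unfolding key[symmetric] by (simp flip: matrix_mul_assoc)
  also have "\<dots> = ?G ** ?P + ?H ** (inverse x *\<^sub>M ((C - mat 1) ** ?P))"
    unfolding P using x0
    by (simp add: matrix_add_rdistrib cscale_mult_left cscale_mult_right matrix_mul_assoc)
  finally show ?thesis
    using deriv by simp
qed

section \<open>Iteration\<close>

lemma commuting_mpoch_self: "commuting (M + mat c) (mpoch M n)"
  by (intro commuting_mpoch commuting_sym[OF commuting_add]) auto

text \<open>In each of the five inductions one more derivative is applied from the outside to the formula for
  order \<open>r\<close>. The new factor \<open>A + rI\<close>, \<open>B + rI\<close>, \<open>(C + rI)\<^sup>-\<^sup>1\<close>, \<open>(I - A + rI)\<^sup>-\<^sup>1\<close> or
  \<open>C - (r + 1)I\<close> then appears inside the product and is moved to its place in the Pochhammer symbol or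
  its inverse, whose factors all commute.\<close>

lemma mderiv_iterate_horn_H4_fst:
  assumes A: "neg_regular A" "\<And>j. j < r \<Longrightarrow> invertible (A + mat (of_nat j))" and C: "nonneg_regular C"
  shows "(mderiv ^^ r) (\<lambda>x. horn_H4 A B C x y)
    = (\<lambda>x. mpoch A r ** horn_H4 (A + mat (of_nat r)) B (C + mat (of_nat r)) x y
        ** matrix_inv (mpoch C r))"
  using A(2)
proof (induction r)
  case (Suc r)
  let ?A = "A + mat (of_nat r)" and ?C = "C + mat (of_nat r)"
  have A': "neg_regular ?A" "invertible ?A" and C': "nonneg_regular ?C"
    using A(1) Suc.prems C by (auto intro!: neg_regular_add nonneg_regular_add)
  have inv: "matrix_inv (mpoch C (Suc r)) = matrix_inv ?C ** matrix_inv (mpoch C r)"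
    using C C' by (simp add: matrix_inv_mult nonneg_regular_mpoch nonneg_regular_invertible)
  have shift: "M + mat (of_nat (Suc r)) = M + mat (of_nat r) + mat 1" for M :: "complex^'a^'a"
    by (simp add: mat_add add_ac)
  have "mderiv ((mderiv ^^ r) (\<lambda>x. horn_H4 A B C x y)) x
      = mpoch A r ** (?A ** horn_H4 (?A + mat 1) B (?C + mat 1) x y ** matrix_inv ?C)
        ** matrix_inv (mpoch C r)" for x
    using Suc by (simp, intro mderiv_eq has_mderiv_mult_left has_mderiv_mult_right
        has_mderiv_horn_H4_fst A' C')
  then show ?case
    unfolding inv shift by (auto simp: matrix_mul_assoc)
qed simp

lemma mderiv_iterate_horn_H4_snd:
  assumes A: "neg_regular A" and C: "nonneg_regular C" and BC: "commuting B C"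
  shows "(mderiv ^^ r) (\<lambda>y. horn_H4 A B C x y)
    = (\<lambda>y. (-1) ^ r *\<^sub>M (matrix_inv (mpoch (mat 1 - A) r)
        ** horn_H4 (A - mat (of_nat r)) (B + mat (of_nat r)) C x y ** mpoch B r))"
proof (induction r)
  case (Suc r)
  let ?A = "A - mat (of_nat r)" and ?B = "B + mat (of_nat r)" and ?N = "mat 1 - A"
  have A': "neg_regular ?A" and N: "nonneg_regular ?N"
    using A by (auto intro!: neg_regular_diff nonneg_regular_one_minus)
  have B': "commuting ?B C"
    using BC by (intro commuting_sym[OF commuting_add[OF commuting_sym]]) auto
  have eq: "mat 1 - ?A = ?N + mat (of_nat r)"
    by simp
  have "mpoch ?N (Suc r) = (?N + mat (of_nat r)) ** mpoch ?N r"
    using commuting_mpoch_self[of ?N "of_nat r" r] by (simp add: commuting_def)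
  then have inv: "matrix_inv (mpoch ?N (Suc r))
      = matrix_inv (mpoch ?N r) ** matrix_inv (?N + mat (of_nat r))"
    using N by (simp add: matrix_inv_mult nonneg_regular_mpoch nonneg_regular_invertible nonneg_regular_add)
  have poch: "mpoch B (Suc r) = ?B ** mpoch B r"
    using commuting_mpoch_self[of B "of_nat r" r] by (simp add: commuting_def)
  have shift: "A - mat (of_nat (Suc r)) = ?A - mat 1" "B + mat (of_nat (Suc r)) = ?B + mat 1"
    by (simp_all add: mat_add add_ac)
  have "has_mderiv (\<lambda>y. mat ((-1) ^ r) ** (matrix_inv (mpoch ?N r) ** horn_H4 ?A ?B C x y ** mpoch B r))
      (mat ((-1) ^ r) ** (matrix_inv (mpoch ?N r) **
        (- (matrix_inv (mat 1 - ?A) ** horn_H4 (?A - mat 1) (?B + mat 1) C x y ** ?B)) ** mpoch B r)) y" for y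
    by (intro has_mderiv_mult_left has_mderiv_mult_right has_mderiv_horn_H4_snd A' C B')
  then have "mderiv ((mderiv ^^ r) (\<lambda>y. horn_H4 A B C x y)) y
      = (-1) ^ r *\<^sub>M (matrix_inv (mpoch ?N r) **
        (- (matrix_inv (mat 1 - ?A) ** horn_H4 (?A - mat 1) (?B + mat 1) C x y ** ?B)) ** mpoch B r)" for y
    unfolding Suc mat_mult_left by (rule mderiv_eq)
  then show ?case
    unfolding inv shift poch eq
    by (auto simp: matrix_mul_assoc matrix_minus_left matrix_minus_right cscale_minus_left cscale_minus_right)
qed simp

lemma open_slit_plane: "open (- \<real>\<^sub>\<le>\<^sub>0 :: complex set)"
  using closed_nonpos_Reals_complex by auto

text \<open>The induction hypothesis identifies an iterate only on the slit plane; since that is open, it may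
  be differentiated there.\<close>

lemma sq_mderiv_eq:
  assumes "has_mderiv g ((1 / x\<^sup>2) *\<^sub>M F) x" "x \<notin> \<real>\<^sub>\<le>\<^sub>0" "\<And>t. t \<notin> \<real>\<^sub>\<le>\<^sub>0 \<Longrightarrow> f t = g t"
  shows "sq_mderiv f x = F"
proof -
  have "has_mderiv f ((1 / x\<^sup>2) *\<^sub>M F) x"
    by (rule has_mderiv_cong_open[OF assms(1) open_slit_plane]) (use assms in auto)
  moreover have "x \<noteq> 0"
    using assms(2) by auto
  ultimately show ?thesis
    by (simp add: sq_mderiv_def mderiv_eq)
qed

lemma sq_mderiv_iterate_cpow_horn_H4:
  assumes A: "neg_regular A" "\<And>j. j < r \<Longrightarrow> invertible (A + mat (of_nat j))" and C: "nonneg_regular C"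
    and x: "x \<notin> \<real>\<^sub>\<le>\<^sub>0"
  shows "(sq_mderiv ^^ r) (\<lambda>x. cpow_matrix x A ** horn_H4 A B C x (y / x)) x
    = cpow_matrix x (A + mat (of_nat r)) ** mpoch A r ** horn_H4 (A + mat (of_nat r)) B C x (y / x)"
  using A(2) x
proof (induction r arbitrary: x)
  case (Suc r)
  let ?A = "A + mat (of_nat r)"
  have A': "neg_regular ?A" "invertible ?A"
    using A(1) Suc.prems by (auto intro!: neg_regular_add)
  have comm: "cpow_matrix t ?A ** mpoch A r = mpoch A r ** cpow_matrix t ?A"
    "cpow_matrix t (?A + mat 1) ** mpoch A r = mpoch A r ** cpow_matrix t (?A + mat 1)" for t
  proof -
    have 1: "commuting (mpoch A r) ?A"
      by (rule commuting_sym[OF commuting_mpoch_self])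
    then have "commuting (mpoch A r) (?A + mat 1)"
      by (rule commuting_add) simp
    with 1 show "cpow_matrix t ?A ** mpoch A r = mpoch A r ** cpow_matrix t ?A"
      "cpow_matrix t (?A + mat 1) ** mpoch A r = mpoch A r ** cpow_matrix t (?A + mat 1)"
      by (metis commuting_cpow_matrix commuting_def)+
  qed
  have "sq_mderiv ((sq_mderiv ^^ r) (\<lambda>x. cpow_matrix x A ** horn_H4 A B C x (y / x))) x
      = mpoch A r ** (cpow_matrix x (?A + mat 1) ** ?A ** horn_H4 (?A + mat 1) B C x (y / x))"
  proof (rule sq_mderiv_eq)
    show "has_mderiv (\<lambda>x. mpoch A r ** (cpow_matrix x ?A ** horn_H4 ?A B C x (y / x)))
      ((1 / x\<^sup>2) *\<^sub>M (mpoch A r ** (cpow_matrix x (?A + mat 1) ** ?A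
        ** horn_H4 (?A + mat 1) B C x (y / x)))) x"
      using has_mderiv_mult_left[OF has_mderiv_cpow_horn_H4_fst[OF A' C Suc.prems(2)]]
      by (simp add: cscale_mult_right)
    show "(sq_mderiv ^^ r) (\<lambda>x. cpow_matrix x A ** horn_H4 A B C x (y / x)) t
        = mpoch A r ** (cpow_matrix t ?A ** horn_H4 ?A B C t (y / t))" if "t \<notin> \<real>\<^sub>\<le>\<^sub>0" for t
      using Suc.IH[OF _ that] Suc.prems(1) by (simp add: comm matrix_mul_assoc)
  qed (fact Suc.prems)
  moreover have "A + mat (of_nat (Suc r)) = ?A + mat 1"
    by (simp add: mat_add add_ac)
  ultimately show ?case
    by (simp only: funpow.simps o_def mpoch.simps matrix_mul_assoc comm)
qed simp

lemma sq_mderiv_iterate_horn_H4_cpow: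
  assumes A: "neg_regular A" and C: "nonneg_regular C" and BC: "commuting B C" and y: "y \<notin> \<real>\<^sub>\<le>\<^sub>0"
  shows "(sq_mderiv ^^ r) (\<lambda>y. horn_H4 A B C x y ** cpow_matrix y B) y
    = horn_H4 A (B + mat (of_nat r)) C x y ** cpow_matrix y (B + mat (of_nat r)) ** mpoch B r"
  using y
proof (induction r arbitrary: y)
  case (Suc r)
  let ?B = "B + mat (of_nat r)"
  have B': "commuting ?B C"
    using BC by (intro commuting_sym[OF commuting_add[OF commuting_sym]]) auto
  have poch: "mpoch B (Suc r) = ?B ** mpoch B r"
    using commuting_mpoch_self[of B "of_nat r" r] by (simp add: commuting_def)
  have "sq_mderiv ((sq_mderiv ^^ r) (\<lambda>y. horn_H4 A B C x y ** cpow_matrix y B)) y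
      = horn_H4 A (?B + mat 1) C x y ** cpow_matrix y (?B + mat 1) ** ?B ** mpoch B r"
  proof (rule sq_mderiv_eq)
    show "has_mderiv (\<lambda>y. horn_H4 A ?B C x y ** cpow_matrix y ?B ** mpoch B r)
      ((1 / y\<^sup>2) *\<^sub>M (horn_H4 A (?B + mat 1) C x y ** cpow_matrix y (?B + mat 1) ** ?B ** mpoch B r)) y"
      using has_mderiv_mult_right[OF has_mderiv_horn_H4_cpow_snd[OF A C B' Suc.prems]]
      by (simp add: cscale_mult_left)
  qed (fact Suc)+
  moreover have "B + mat (of_nat (Suc r)) = ?B + mat 1"
    by (simp add: mat_add add_ac)
  ultimately show ?case
    unfolding poch by (simp only: funpow.simps o_def matrix_mul_assoc)
qed simp

lemma mderiv_iterate_horn_H4_cpow: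
  assumes A: "neg_regular A" and C: "nonneg_regular (C - mat (of_nat r))" and x: "x \<notin> \<real>\<^sub>\<le>\<^sub>0"
  shows "(mderiv ^^ r) (\<lambda>x. horn_H4 A B C x y ** cpow_matrix x (C - mat 1)) x
    = (-1) ^ r *\<^sub>M (horn_H4 A B (C - mat (of_nat r)) x y
        ** cpow_matrix x (C - mat (of_nat r + 1)) ** mpoch (mat 1 - C) r)"
  using C x
proof (induction r arbitrary: x)
  case (Suc r)
  let ?C = "C - mat (of_nat r)" and ?N = "mat 1 - C"
  have Suc_r: "C - mat (of_nat (Suc r)) = ?C - mat 1"
    by (simp add: mat_add)
  have C1: "nonneg_regular (?C - mat 1)"
    using Suc.prems(1) unfolding Suc_r .
  then have C': "nonneg_regular ?C"
    using nonneg_regular_add_one by fastforce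
  have exponent: "C - mat (of_nat r + 1) = ?C - mat 1" "C - mat (of_nat (Suc r) + 1) = ?C - mat 2"
    by (simp_all add: vec_eq_iff mat_def)
  have poch: "mpoch ?N (Suc r) = - ((?C - mat 1) ** mpoch ?N r)"
  proof -
    have "mpoch ?N (Suc r) = (?N + mat (of_nat r)) ** mpoch ?N r"
      using commuting_mpoch_self[of ?N "of_nat r" r] by (simp add: commuting_def)
    also have "?N + mat (of_nat r) = - (?C - mat 1)"
      by simp
    finally show ?thesis
      by (simp only: matrix_minus_left)
  qed
  have "has_mderiv (\<lambda>x. mat ((-1) ^ r) ** (horn_H4 A B ?C x y ** cpow_matrix x (?C - mat 1) ** mpoch ?N r))
    (mat ((-1) ^ r) ** (horn_H4 A B (?C - mat 1) x y ** cpow_matrix x (?C - mat 2) ** (?C - mat 1) ** mpoch ?N r)) x"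
    by (intro has_mderiv_mult_left has_mderiv_mult_right has_mderiv_horn_H4_cpow_fst A C' C1 Suc.prems)
  then have "has_mderiv ((mderiv ^^ r) (\<lambda>x. horn_H4 A B C x y ** cpow_matrix x (C - mat 1)))
    (mat ((-1) ^ r) ** (horn_H4 A B (?C - mat 1) x y ** cpow_matrix x (?C - mat 2) ** (?C - mat 1) ** mpoch ?N r)) x"
    by (rule has_mderiv_cong_open[OF _ open_slit_plane])
      (use Suc.prems Suc.IH[OF C'] in \<open>auto simp: mat_mult_left exponent\<close>)
  then have "(mderiv ^^ Suc r) (\<lambda>x. horn_H4 A B C x y ** cpow_matrix x (C - mat 1)) x
    = (-1) ^ r *\<^sub>M (horn_H4 A B (?C - mat 1) x y ** cpow_matrix x (?C - mat 2) ** ((?C - mat 1) ** mpoch ?N r))"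
    by (simp add: mderiv_eq mat_mult_left cscale_mult_left matrix_mul_assoc)
  also have "\<dots> = (-1) ^ Suc r *\<^sub>M (horn_H4 A B (?C - mat 1) x y ** cpow_matrix x (?C - mat 2) ** mpoch ?N (Suc r))"
    unfolding poch by (simp add: matrix_minus_right cscale_minus_left cscale_minus_right)
  finally show ?case
    unfolding exponent Suc_r .
qed simp

section \<open>Differential formulae of order \<open>r\<close>\<close>

theorem theorem4p16:
  fixes A B' C :: "complex^'d^'d" and r :: nat
  assumes C: "\<And>k::nat. invertible (C + mat (of_nat k))"
    and A: "\<And>k::nat. k \<ge> 1 \<Longrightarrow> invertible (A - mat (of_nat k))"
    and r: "r > 0"
  shows
    "((\<forall>k::nat. k \<ge> 1 \<longrightarrow> invertible (A + mat (of_nat r) - mat (of_nat k))) \<longrightarrow>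
       (\<forall>x y. (mderiv ^^ r) (\<lambda>x. horn_H4 A B' C x y) x =
          mpoch A r ** horn_H4 (A + mat (of_nat r)) B' (C + mat (of_nat r)) x y
            ** matrix_inv (mpoch C r))) \<and>
     (B' ** C = C ** B' \<longrightarrow>
       (\<forall>x y. (mderiv ^^ r) (\<lambda>y. horn_H4 A B' C x y) y =
          (-1) ^ r *\<^sub>M (matrix_inv (mpoch (mat 1 - A) r)
            ** horn_H4 (A - mat (of_nat r)) (B' + mat (of_nat r)) C x y ** mpoch B' r))) \<and>
     ((\<forall>k::nat. k \<ge> 1 \<longrightarrow> invertible (A + mat (of_nat r) - mat (of_nat k))) \<longrightarrow>
       (\<forall>x y. x \<notin> \<real>\<^sub>\<le>\<^sub>0 \<longrightarrow>
          (sq_mderiv ^^ r) (\<lambda>x. cpow_matrix x A ** horn_H4 A B' C x (y / x)) x =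
          cpow_matrix x (A + mat (of_nat r)) ** mpoch A r
            ** horn_H4 (A + mat (of_nat r)) B' C x (y / x))) \<and>
     (B' ** C = C ** B' \<longrightarrow>
       (\<forall>x y. y \<notin> \<real>\<^sub>\<le>\<^sub>0 \<longrightarrow>
          (sq_mderiv ^^ r) (\<lambda>y. horn_H4 A B' C x y ** cpow_matrix y B') y =
          horn_H4 A (B' + mat (of_nat r)) C x y ** cpow_matrix y (B' + mat (of_nat r))
            ** mpoch B' r)) \<and>
     ((\<forall>k::nat. invertible (C - mat (of_nat r) + mat (of_nat k))) \<longrightarrow>
       (\<forall>x y. x \<notin> \<real>\<^sub>\<le>\<^sub>0 \<longrightarrow>
          (mderiv ^^ r) (\<lambda>x. horn_H4 A B' C x y ** cpow_matrix x (C - mat 1)) x =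
          (-1) ^ r *\<^sub>M (horn_H4 A B' (C - mat (of_nat r)) x y
            ** cpow_matrix x (C - mat (of_nat r + 1)) ** mpoch (mat 1 - C) r)))"
proof -
  have C': "nonneg_regular C"
    using C by (simp add: nonneg_regular_def)
  have A': "neg_regular A"
    using A by (simp add: neg_regular_def)
  have A_up: "invertible (A + mat (of_nat j))"
    if "\<forall>k::nat. k \<ge> 1 \<longrightarrow> invertible (A + mat (of_nat r) - mat (of_nat k))" "j < r" for j
  proof -
    have "A + mat (of_nat r) - mat (of_nat (r - j)) = A + mat (of_nat j)"
      using that(2) by (simp add: of_nat_diff mat_diff)
    moreover have "invertible (A + mat (of_nat r) - mat (of_nat (r - j)))"
      by (rule that(1)[rule_format]) (use that(2) in simp)
    ultimately show ?thesis
      by (simp only:)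
  qed
  show ?thesis
  proof (intro conjI impI allI)
    fix x y
    assume up: "\<forall>k::nat. k \<ge> 1 \<longrightarrow> invertible (A + mat (of_nat r) - mat (of_nat k))"
    show "(mderiv ^^ r) (\<lambda>x. horn_H4 A B' C x y) x
        = mpoch A r ** horn_H4 (A + mat (of_nat r)) B' (C + mat (of_nat r)) x y
          ** matrix_inv (mpoch C r)"
      by (simp only: mderiv_iterate_horn_H4_fst[OF A' A_up[OF up] C'])
  next
    fix x y
    assume "B' ** C = C ** B'"
    then show "(mderiv ^^ r) (\<lambda>y. horn_H4 A B' C x y) y
        = (-1) ^ r *\<^sub>M (matrix_inv (mpoch (mat 1 - A) r)
          ** horn_H4 (A - mat (of_nat r)) (B' + mat (of_nat r)) C x y ** mpoch B' r)"
      using mderiv_iterate_horn_H4_snd[OF A' C'] by (simp only: commuting_def)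
  next
    fix x y :: complex
    assume "\<forall>k::nat. k \<ge> 1 \<longrightarrow> invertible (A + mat (of_nat r) - mat (of_nat k))" "x \<notin> \<real>\<^sub>\<le>\<^sub>0"
    then show "(sq_mderiv ^^ r) (\<lambda>x. cpow_matrix x A ** horn_H4 A B' C x (y / x)) x
        = cpow_matrix x (A + mat (of_nat r)) ** mpoch A r ** horn_H4 (A + mat (of_nat r)) B' C x (y / x)"
      using sq_mderiv_iterate_cpow_horn_H4[OF A' A_up C'] by blast
  next
    fix x y :: complex
    assume "B' ** C = C ** B'" "y \<notin> \<real>\<^sub>\<le>\<^sub>0"
    then show "(sq_mderiv ^^ r) (\<lambda>y. horn_H4 A B' C x y ** cpow_matrix y B') y
        = horn_H4 A (B' + mat (of_nat r)) C x y ** cpow_matrix y (B' + mat (of_nat r)) ** mpoch B' r"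
      using sq_mderiv_iterate_horn_H4_cpow[OF A' C'] by (simp only: commuting_def)
  next
    fix x y :: complex
    assume "\<forall>k::nat. invertible (C - mat (of_nat r) + mat (of_nat k))" "x \<notin> \<real>\<^sub>\<le>\<^sub>0"
    then show "(mderiv ^^ r) (\<lambda>x. horn_H4 A B' C x y ** cpow_matrix x (C - mat 1)) x
        = (-1) ^ r *\<^sub>M (horn_H4 A B' (C - mat (of_nat r)) x y
          ** cpow_matrix x (C - mat (of_nat r + 1)) ** mpoch (mat 1 - C) r)"
      by (intro mderiv_iterate_horn_H4_cpow A') (simp_all add: nonneg_regular_def)
  qed
qed

end
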